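(* In the setting described in the context, for $n\in\mathbb N$ and $\xi_1,\dots,\xi_n\in\mathcal F(X)$, $$\tau_\sigma\big(R(\xi_1)\cdots R(\xi_n)\big)=\mathbb E_\sigma(p),\qquad p(\omega):=\langle\omega,\xi_1\rangle\cdots\langle\omega,\xi_n\rangle,$$ where $\mathbb E_\sigma$ is the Poisson functional with intensity measure $\sigma$.
   Context: Let $X$ be a locally compact Polish space, $\mathbb F\in\{\mathbb R,\mathbb C\}$, $M(X)$ the set of $\mathbb F$-valued Radon measures on $X$, $\mathcal F(X)$ the bounded measurable compactly supported functions $X\to\mathbb F$, and for $k\ge1$, $\mathcal F^{(k)}(X)$ the bounded measurable symmetric compactly supported functions on $X^k$; $\langle\mu,f\rangle:=\int f\,d\mu$. Fix $\sigma\in M(X)$. Let $V$ be a vector space and $a^+(\xi),a^-(\xi),\rho(\xi)$, $\xi\in\mathcal F(X)$, linear operators on $V$ depending linearly on $\xi$ such that $[a^+(\varphi),a^+(\xi)]=[a^-(\varphi),a^-(\xi)]=0$, $[a^-(\varphi),a^+(\xi)]=\int_X\varphi\xi\,d\sigma$, $[\rho(\varphi),\rho(\xi)]=0$, $[\rho(\varphi),a^+(\xi)]=a^+(\varphi\xi)$, $[a^-(\xi),\rho(\varphi)]=a^-(\varphi\xi)$, where $[A,B]=AB-BA$. Let $\mathbf A$ be the unital algebra generated by all $a^+(\xi),a^-(\xi),\rho(\xi)$ and the identity $\mathbf 1$; every element of $\mathbf A$ is a linear combination of $\mathbf 1$ and operators $a^+(\varphi)^i\rho(\psi)^ja^-(\xi)^k$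 with $i+j+k\ge1$. The vacuum functional $\tau_\sigma$ is the linear functional on $\mathbf A$ with $\tau_\sigma(\mathbf 1)=1$ and $\tau_\sigma(a^+(\varphi)^i\rho(\psi)^ja^-(\xi)^k)=0$ whenever $i,j,k\in\mathbb N_0$, $i+j+k\ge1$. Set $R(\xi):=a^+(\xi)+a^-(\xi)+\rho(\xi)+\langle\sigma,\xi\rangle\mathbf 1$. Poisson functional: for a polynomial $p(\omega)=\sum_{k=0}^N\langle\omega^{\otimes k},f^{(k)}\rangle$ ($f^{(k)}\in\mathcal F^{(k)}(X)$, $\omega^{\otimes0}=1$) choose a relatively compact Borel $\Lambda$ with each $f^{(k)}$ vanishing outside $\Lambda^k$ and set $\mathbb E_\sigma(p):=e^{-\sigma(\Lambda)}\sum_{m\ge0}\frac1{m!}\int_{\Lambda^m}p(\delta_{x_1}+\dots+\delta_{x_m})\,\sigma^{\otimes m}(dx_1\cdots dx_m)$ (the $m=0$ term is $p(0)$); this is independent of $\Lambda$. *)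

theory Defs
  imports "HOL-Analysis.Analysis"
begin

text \<open>
  The scalar field is a type of sort {real_normed_field, euclidean_space}; both type real and
  type complex are instances and, up to isometric isomorphism, they are the only ones (a
  commutative real normed division algebra).  The
  underlying space is a type of class polish_space; local compactness is a separate assumption.
\<close>

section \<open>Radon measures with values in the field\<close>

definition relcompact_borel :: "'x::polish_space set set" where
  "relcompact_borel = {A \<in> sets borel. compact (closure A)}"

text \<open>
  A field-valued Radon measure may have infinite total variation, so it is a countably additive
  function on the relatively compact Borel sets; its values on other sets are irrelevant.
  Regularity is automatic on a locally compact Polish space.
\<close>

definition radon_measures :: "('x::polish_space set \<Rightarrow> 'f::{real_normed_field,euclidean_space}) set" where
  "radon_measures = {\<sigma>. \<forall>A :: nat \<Rightarrow> 'x set.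
     range A \<subseteq> relcompact_borel \<longrightarrow> disjoint_family A \<longrightarrow> (\<Union>i. A i) \<in> relcompact_borel \<longrightarrow>
     (\<lambda>i. \<sigma> (A i)) sums \<sigma> (\<Union>i. A i)}"

text \<open>
  Upper variation of a real-valued Radon measure \<open>\<nu>\<close>, as a positive Borel measure; the Jordan
  decomposition of \<open>\<nu>\<close> consists of the upper variations of \<open>\<nu>\<close> and \<open>-\<nu>\<close>.  (\<open>ennreal\<close> sends negative
  numbers to \<open>0\<close>.)
\<close>

definition upper_variation :: "('x::polish_space set \<Rightarrow> real) \<Rightarrow> 'x measure" where
  "upper_variation \<nu> =
     measure_of UNIV (sets borel) (\<lambda>A. SUP B\<in>{B \<in> relcompact_borel. B \<subseteq> A}. ennreal (\<nu> B))"

text \<open>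
  Jordan decomposition of the coordinates of \<open>\<sigma>\<close>: on relatively compact Borel sets, \<open>\<sigma>\<close> is the sum
  over \<open>(b, s) \<in> jordan_index\<close> of \<open>jordan_coeff (b, s)\<close> times the positive Radon measure
  \<open>jordan_part \<sigma> (b, s)\<close>.  For the reals \<open>b = 1\<close>; for the complex numbers \<open>b\<close> is \<open>1\<close> or \<open>\<i>\<close>.
\<close>

definition jordan_index :: "('f::{real_normed_field,euclidean_space} \<times> real) set" where
  "jordan_index = Basis \<times> {1, -1}"

definition jordan_coeff :: "'f::{real_normed_field,euclidean_space} \<times> real \<Rightarrow> 'f" where
  "jordan_coeff j = snd j *\<^sub>R fst j"

definition jordan_part ::
  "('x::polish_space set \<Rightarrow> 'f::{real_normed_field,euclidean_space}) \<Rightarrow> 'f \<times> real \<Rightarrow> 'x measure" where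
  "jordan_part \<sigma> j = upper_variation (\<lambda>A. snd j * (\<sigma> A \<bullet> fst j))"

definition pairing ::
  "('x::polish_space set \<Rightarrow> 'f) \<Rightarrow> ('x \<Rightarrow> 'f) \<Rightarrow> 'f::{real_normed_field,euclidean_space}" where
  "pairing \<sigma> f = (\<Sum>j\<in>jordan_index. jordan_coeff j * (LINT x|jordan_part \<sigma> j. f x))"

text \<open>
  \<open>pairing_power k \<sigma> f\<close> is the integral of \<open>f\<close> with respect to the \<open>k\<close>-fold product measure of \<open>\<sigma>\<close>,
  which is given by multilinear expansion of the decomposition above.  Points of \<open>X\<^sup>k\<close> are extensional
  functions on \<open>{..<k}\<close>; for \<open>k = 0\<close> there is one point, and the product measure has mass \<open>1\<close> there.
\<close>

definition pairing_power ::
  "nat \<Rightarrow> ('x::polish_space set \<Rightarrow> 'f) \<Rightarrow> ((nat \<Rightarrow> 'x) \<Rightarrow> 'f) \<Rightarrow> 'f::{real_normed_field,euclidean_space}" where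
  "pairing_power k \<sigma> f =
     (\<Sum>c\<in>({..<k} \<rightarrow>\<^sub>E jordan_index).
        (\<Prod>i<k. jordan_coeff (c i)) * (LINT x|(\<Pi>\<^sub>M i\<in>{..<k}. jordan_part \<sigma> (c i)). f x))"

section \<open>Test functions\<close>

definition test_functions :: "('x::polish_space \<Rightarrow> 'f::{real_normed_field,euclidean_space}) set" where
  "test_functions = {\<xi> \<in> borel_measurable borel.
     bounded (range \<xi>) \<and> (\<exists>K. compact K \<and> (\<forall>x. x \<notin> K \<longrightarrow> \<xi> x = 0))}"

definition vanishes_outside :: "nat \<Rightarrow> 'x set \<Rightarrow> ((nat \<Rightarrow> 'x) \<Rightarrow> 'f::zero) \<Rightarrow> bool" where
  "vanishes_outside k \<Lambda> f \<longleftrightarrow>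
     (\<forall>x \<in> ({..<k} \<rightarrow>\<^sub>E UNIV) - ({..<k} \<rightarrow>\<^sub>E \<Lambda>). f x = 0)"

text \<open>For \<open>k = 0\<close> all functions (of the single point of \<open>X\<^sup>0\<close>) are admitted, that is, all constants.\<close>

definition sym_test_functions ::
  "nat \<Rightarrow> ((nat \<Rightarrow> 'x::polish_space) \<Rightarrow> 'f::{real_normed_field,euclidean_space}) set" where
  "sym_test_functions k = {f \<in> borel_measurable (\<Pi>\<^sub>M i\<in>{..<k}. borel).
     bounded (f ` ({..<k} \<rightarrow>\<^sub>E UNIV)) \<and>
     (\<forall>\<pi>. \<pi> permutes {..<k} \<longrightarrow> (\<forall>x \<in> {..<k} \<rightarrow>\<^sub>E UNIV. f (x \<circ> \<pi>) = f x)) \<and>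
     (\<exists>K. compact K \<and> vanishes_outside k K f)}"

section \<open>The Poisson functional\<close>

definition poly_repr ::
  "(('x::polish_space set \<Rightarrow> 'f) \<Rightarrow> 'f::{real_normed_field,euclidean_space}) \<Rightarrow>
     nat \<Rightarrow> (nat \<Rightarrow> (nat \<Rightarrow> 'x) \<Rightarrow> 'f) \<Rightarrow> bool" where
  "poly_repr p N f \<longleftrightarrow>
     (\<forall>k\<le>N. f k \<in> sym_test_functions k) \<and>
     (\<forall>\<omega>\<in>radon_measures. p \<omega> = (\<Sum>k\<le>N. pairing_power k \<omega> (f k)))"

definition dirac_sum :: "nat \<Rightarrow> (nat \<Rightarrow> 'x) \<Rightarrow> 'x set \<Rightarrow> 'f::real_normed_field" where
  "dirac_sum m x = (\<lambda>A. \<Sum>i<m. indicator A (x i))"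

definition poisson_expectation_on ::
  "('x::polish_space set \<Rightarrow> 'f) \<Rightarrow> 'x set \<Rightarrow> (('x set \<Rightarrow> 'f) \<Rightarrow> 'f) \<Rightarrow>
     'f::{real_normed_field,euclidean_space}" where
  "poisson_expectation_on \<sigma> \<Lambda> p = exp (- \<sigma> \<Lambda>) *
     (\<Sum>m. inverse (fact m) *
        pairing_power m \<sigma> (\<lambda>x. indicator ({..<m} \<rightarrow>\<^sub>E \<Lambda>) x * p (dirac_sum m x)))"

definition poisson_functional ::
  "('x::polish_space set \<Rightarrow> 'f) \<Rightarrow> (('x set \<Rightarrow> 'f) \<Rightarrow> 'f) \<Rightarrow>
     'f::{real_normed_field,euclidean_space}" where
  "poisson_functional \<sigma> p = poisson_expectation_on \<sigma>
     (SOME \<Lambda>. \<Lambda> \<in> relcompact_borel \<and>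
        (\<exists>N f. poly_repr p N f \<and> (\<forall>k\<le>N. vanishes_outside k \<Lambda> (f k)))) p"

section \<open>Operators and the vacuum functional\<close>

definition commutator :: "('v \<Rightarrow> 'v) \<Rightarrow> ('v \<Rightarrow> 'v) \<Rightarrow> 'v \<Rightarrow> 'v::ab_group_add" where
  "commutator A B = (\<lambda>v. A (B v) - B (A v))"

definition linear_operator_family ::
  "('f::{real_normed_field,euclidean_space} \<Rightarrow> 'v::ab_group_add \<Rightarrow> 'v) \<Rightarrow>
     (('x::polish_space \<Rightarrow> 'f) \<Rightarrow> 'v \<Rightarrow> 'v) \<Rightarrow> bool" where
  "linear_operator_family smul T \<longleftrightarrow>
     (\<forall>\<xi>\<in>test_functions. Vector_Spaces.linear smul smul (T \<xi>)) \<and>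
     (\<forall>\<phi>\<in>test_functions. \<forall>\<xi>\<in>test_functions. T (\<lambda>x. \<phi> x + \<xi> x) = (\<lambda>v. T \<phi> v + T \<xi> v)) \<and>
     (\<forall>c. \<forall>\<xi>\<in>test_functions. T (\<lambda>x. c * \<xi> x) = (\<lambda>v. smul c (T \<xi> v)))"

locale current_operators =
  vector_space smul
  for smul :: "'f::{real_normed_field,euclidean_space} \<Rightarrow> 'v::ab_group_add \<Rightarrow> 'v" +
  fixes \<sigma> :: "'x::polish_space set \<Rightarrow> 'f"
    and ap am rho :: "('x \<Rightarrow> 'f) \<Rightarrow> 'v \<Rightarrow> 'v"
  assumes lin_ap: "linear_operator_family smul ap"
    and lin_am: "linear_operator_family smul am"
    and lin_rho: "linear_operator_family smul rho"
    and ap_ap: "\<lbrakk>\<phi> \<in> test_functions; \<xi> \<in> test_functions\<rbrakk> \<Longrightarrow> commutator (ap \<phi>) (ap \<xi>) = (\<lambda>v. 0)"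
    and am_am: "\<lbrakk>\<phi> \<in> test_functions; \<xi> \<in> test_functions\<rbrakk> \<Longrightarrow> commutator (am \<phi>) (am \<xi>) = (\<lambda>v. 0)"
    and am_ap: "\<lbrakk>\<phi> \<in> test_functions; \<xi> \<in> test_functions\<rbrakk> \<Longrightarrow>
      commutator (am \<phi>) (ap \<xi>) = smul (pairing \<sigma> (\<lambda>x. \<phi> x * \<xi> x))"
    and rho_rho: "\<lbrakk>\<phi> \<in> test_functions; \<xi> \<in> test_functions\<rbrakk> \<Longrightarrow> commutator (rho \<phi>) (rho \<xi>) = (\<lambda>v. 0)"
    and rho_ap: "\<lbrakk>\<phi> \<in> test_functions; \<xi> \<in> test_functions\<rbrakk> \<Longrightarrow>
      commutator (rho \<phi>) (ap \<xi>) = ap (\<lambda>x. \<phi> x * \<xi> x)"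
    and am_rho: "\<lbrakk>\<phi> \<in> test_functions; \<xi> \<in> test_functions\<rbrakk> \<Longrightarrow>
      commutator (am \<xi>) (rho \<phi>) = am (\<lambda>x. \<phi> x * \<xi> x)"

inductive_set generated_algebra ::
  "('f \<Rightarrow> 'v::ab_group_add \<Rightarrow> 'v) \<Rightarrow> ('v \<Rightarrow> 'v) set \<Rightarrow> ('v \<Rightarrow> 'v) set"
  for smul :: "'f \<Rightarrow> 'v \<Rightarrow> 'v" and G :: "('v \<Rightarrow> 'v) set"
where
  one: "id \<in> generated_algebra smul G"
| gen: "T \<in> G \<Longrightarrow> T \<in> generated_algebra smul G"
| add: "\<lbrakk>S \<in> generated_algebra smul G; T \<in> generated_algebra smul G\<rbrakk> \<Longrightarrow>
    (\<lambda>v. S v + T v) \<in> generated_algebra smul G"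
| smult: "T \<in> generated_algebra smul G \<Longrightarrow> (\<lambda>v. smul c (T v)) \<in> generated_algebra smul G"
| mult: "\<lbrakk>S \<in> generated_algebra smul G; T \<in> generated_algebra smul G\<rbrakk> \<Longrightarrow>
    S \<circ> T \<in> generated_algebra smul G"

definition current_algebra ::
  "('f::{real_normed_field,euclidean_space} \<Rightarrow> 'v::ab_group_add \<Rightarrow> 'v) \<Rightarrow>
     (('x::polish_space \<Rightarrow> 'f) \<Rightarrow> 'v \<Rightarrow> 'v) \<Rightarrow> (('x \<Rightarrow> 'f) \<Rightarrow> 'v \<Rightarrow> 'v) \<Rightarrow> (('x \<Rightarrow> 'f) \<Rightarrow> 'v \<Rightarrow> 'v) \<Rightarrow>
     ('v \<Rightarrow> 'v) set" where
  "current_algebra smul ap am rho =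
     generated_algebra smul (ap ` test_functions \<union> am ` test_functions \<union> rho ` test_functions)"

definition vacuum_functional ::
  "('f::{real_normed_field,euclidean_space} \<Rightarrow> 'v::ab_group_add \<Rightarrow> 'v) \<Rightarrow>
     (('x::polish_space \<Rightarrow> 'f) \<Rightarrow> 'v \<Rightarrow> 'v) \<Rightarrow> (('x \<Rightarrow> 'f) \<Rightarrow> 'v \<Rightarrow> 'v) \<Rightarrow> (('x \<Rightarrow> 'f) \<Rightarrow> 'v \<Rightarrow> 'v) \<Rightarrow>
     (('v \<Rightarrow> 'v) \<Rightarrow> 'f) \<Rightarrow> bool" where
  "vacuum_functional smul ap am rho \<tau> \<longleftrightarrow>
     (\<forall>S\<in>current_algebra smul ap am rho. \<forall>T\<in>current_algebra smul ap am rho.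
        \<tau> (\<lambda>v. S v + T v) = \<tau> S + \<tau> T) \<and>
     (\<forall>c. \<forall>T\<in>current_algebra smul ap am rho. \<tau> (\<lambda>v. smul c (T v)) = c * \<tau> T) \<and>
     \<tau> id = 1 \<and>
     (\<forall>\<phi>\<in>test_functions. \<forall>\<psi>\<in>test_functions. \<forall>\<xi>\<in>test_functions. \<forall>i j k :: nat.
        i + j + k \<ge> 1 \<longrightarrow> \<tau> ((ap \<phi> ^^ i) \<circ> (rho \<psi> ^^ j) \<circ> (am \<xi> ^^ k)) = 0)"

definition field_operator ::
  "('f::{real_normed_field,euclidean_space} \<Rightarrow> 'v::ab_group_add \<Rightarrow> 'v) \<Rightarrow> ('x::polish_space set \<Rightarrow> 'f) \<Rightarrow>
     (('x \<Rightarrow> 'f) \<Rightarrow> 'v \<Rightarrow> 'v) \<Rightarrow> (('x \<Rightarrow> 'f) \<Rightarrow> 'v \<Rightarrow> 'v) \<Rightarrow> (('x \<Rightarrow> 'f) \<Rightarrow> 'v \<Rightarrow> 'v) \<Rightarrow>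
     ('x \<Rightarrow> 'f) \<Rightarrow> 'v \<Rightarrow> 'v" where
  "field_operator smul \<sigma> ap am rho \<xi> =
     (\<lambda>v. ap \<xi> v + am \<xi> v + rho \<xi> v + smul (pairing \<sigma> \<xi>) v)"

end

theory Submission
  imports Defs "HOL-Computational_Algebra.Polynomial" "HOL-Combinatorics.Permutations"
begin

text \<open>
  Normal ordering and polarization show that \<open>\<tau>\<close> annihilates every \<open>a\<^sup>+(\<phi>) S\<close>, \<open>\<rho>(\<phi>) S\<close> and \<open>S a\<^sup>-(\<phi>)\<close>.
  With \<open>b(\<phi>) = a\<^sup>-(\<phi>) + \<langle>\<sigma>, \<phi>\<rangle>\<close> one has \<open>b(\<phi>) R(\<xi>) = R(\<xi>) b(\<phi>) + b(\<phi> \<xi>)\<close>, so moving \<open>b\<close> to the right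
  expresses \<open>\<tau>(R(\<phi>) R(\<xi>\<^sub>1) \<dots> R(\<xi>\<^sub>n)) = \<tau>(b(\<phi>) R(\<xi>\<^sub>1) \<dots> R(\<xi>\<^sub>n))\<close> through shorter products.  The Mecke
  identity gives the same recursion for the Poisson moments, and the recursion determines both sides.
\<close>

section \<open>Test functions\<close>

text \<open>The vacuum functional is prescribed only on powers of one a^+, one \<rho> and one a^-,
  whereas normal ordering of R(\<xi>_1)...R(\<xi>_n) produces words with many different arguments;
  this gap is what polarization closes.

  Since \<sigma> may be signed or complex, the Poisson side offers no positivity. Its moments are
  therefore computed algebraically, from the functional \<open>pairing \<sigma>\<close> and its
  tensor powers. Measure theory serves to identify product integrals with these powers, and
  convergence of the series is inherited from the exponential series through the recursion.

  A further obstacle is the region of integration: \<open>poisson_functional\<close> picks some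
  \<Lambda> through a representation of p, and nothing says outright that this \<Lambda> contains
  the supports of the \<xi>_i. If no \<xi>_i vanishes identically it must, because the values of p
  on finitely supported measures detect every point where some \<xi>_i is nonzero. If some \<xi>_i
  is zero, then p = 0 and every region gives 0.\<close>

lemma test_functions_add:
  assumes "f \<in> test_functions" "g \<in> test_functions"
  shows "(\<lambda>x. f x + g x) \<in> test_functions"
proof -
  obtain K L where "compact K" "\<forall>x. x \<notin> K \<longrightarrow> f x = 0" "compact L" "\<forall>x. x \<notin> L \<longrightarrow> g x = 0"
    using assms by (auto simp: test_functions_def)
  then have "compact (K \<union> L)" "\<forall>x. x \<notin> K \<union> L \<longrightarrow> f x + g x = 0"
    by auto
  moreover have "bounded (range (\<lambda>x. f x + g x))"
    using assms by (auto simp: test_functions_def intro!: bounded_plus_comp)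
  ultimately show ?thesis
    using assms by (auto simp: test_functions_def intro!: borel_measurable_add)
qed

lemma test_functions_mult:
  fixes f g :: "'x::polish_space \<Rightarrow> 'f::{real_normed_field,euclidean_space}"
  assumes "f \<in> test_functions" "g \<in> test_functions"
  shows "(\<lambda>x. f x * g x) \<in> test_functions"
proof -
  obtain a b where "\<And>x. norm (f x) \<le> a" "\<And>x. norm (g x) \<le> b"
    using assms by (auto simp: test_functions_def bounded_iff)
  then have "norm (f x * g x) \<le> a * b" for x
    by (smt (verit, best) mult_mono norm_ge_zero norm_mult)
  then have "bounded (range (\<lambda>x. f x * g x))"
    by (auto simp: bounded_iff)
  moreover obtain K where "compact K" "\<forall>x. x \<notin> K \<longrightarrow> f x = 0"
    using assms by (auto simp: test_functions_def)
  ultimately show ?thesis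
    using assms by (auto simp: test_functions_def intro!: borel_measurable_times)
qed

lemma test_functions_cmult:
  fixes f :: "'x::polish_space \<Rightarrow> 'f::{real_normed_field,euclidean_space}"
  assumes "f \<in> test_functions"
  shows "(\<lambda>x. c * f x) \<in> test_functions"
proof -
  obtain a where "\<And>x. norm (f x) \<le> a"
    using assms by (auto simp: test_functions_def bounded_iff)
  then have "norm (c * f x) \<le> norm c * a" for x
    by (simp add: mult_left_mono norm_mult)
  then have "bounded (range (\<lambda>x. c * f x))"
    by (auto simp: bounded_iff)
  moreover obtain K where "compact K" "\<forall>x. x \<notin> K \<longrightarrow> f x = 0"
    using assms by (auto simp: test_functions_def)
  ultimately show ?thesis
    using assms by (auto simp: test_functions_def)
qed

lemma test_functions_zero: "(\<lambda>_. 0) \<in> test_functions"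
  by (auto simp: test_functions_def bounded_iff intro!: exI[of _ "{}"])

lemma indicator_test_function:
  assumes "\<Lambda> \<in> relcompact_borel"
  shows "(indicator \<Lambda> :: _ \<Rightarrow> 'f::{real_normed_field,euclidean_space}) \<in> test_functions"
proof -
  have "bounded (range (indicator \<Lambda> :: _ \<Rightarrow> 'f))"
    by (auto simp: bounded_iff indicator_def intro!: exI[of _ 1])
  then show ?thesis
    using assms closure_subset[of \<Lambda>]
    by (auto simp: test_functions_def relcompact_borel_def indicator_def
        intro!: exI[of _ "closure \<Lambda>"])
qed

section \<open>The moment recursion\<close>

text \<open>
  \<open>absorb w \<phi> L f\<close> is the sum over all sublists \<open>T\<close> of \<open>L\<close> of \<open>w (\<phi> \<cdot> \<Prod>T) * f (L - T)\<close>.  The moments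
  \<open>\<mu>\<close> of the Poisson distribution with \<open>w = pairing \<sigma>\<close> satisfy \<open>\<mu> (\<phi> # L) = absorb w \<phi> L \<mu>\<close>,
  which is the relation between moments and cumulants.
\<close>

primrec absorb ::
  "(('x \<Rightarrow> 'f::comm_ring_1) \<Rightarrow> 'f) \<Rightarrow> ('x \<Rightarrow> 'f) \<Rightarrow> ('x \<Rightarrow> 'f) list \<Rightarrow> (('x \<Rightarrow> 'f) list \<Rightarrow> 'f) \<Rightarrow> 'f"
where
  "absorb w \<phi> [] f = w \<phi> * f []"
| "absorb w \<phi> (\<xi> # L) f = absorb w \<phi> L (\<lambda>M. f (\<xi> # M)) + absorb w (\<lambda>x. \<phi> x * \<xi> x) L f"

text \<open>\<open>absorb\<close> evaluates \<open>f\<close> only at sublists of \<open>L\<close>.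
  The length bound lets a strong induction over the length use this.\<close>

lemma absorb_cong:
  assumes "\<And>M. M \<in> lists T \<Longrightarrow> length M \<le> length L \<Longrightarrow> f M = g M" "L \<in> lists T"
  shows "absorb w \<phi> L f = absorb w \<phi> L g"
  using assms
proof (induction L arbitrary: \<phi> f g)
  case (Cons \<xi> L)
  have "absorb w \<phi> L (\<lambda>M. f (\<xi> # M)) = absorb w \<phi> L (\<lambda>M. g (\<xi> # M))" for \<phi>
    by (rule Cons.IH) (use Cons.prems in auto)
  moreover have "absorb w \<phi> L f = absorb w \<phi> L g" for \<phi>
    by (rule Cons.IH) (use Cons.prems in auto)
  ultimately show ?case by simp
qed simp

lemma absorb_cmult: "absorb w \<phi> L (\<lambda>M. c * f M) = c * absorb w \<phi> L f"
  by (induction L arbitrary: \<phi> f) (simp_all add: algebra_simps)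

lemma absorb_sum:
  "finite J \<Longrightarrow> absorb w \<phi> L (\<lambda>M. \<Sum>j\<in>J. f j M) = (\<Sum>j\<in>J. absorb w \<phi> L (f j))"
  by (induction L arbitrary: \<phi> f) (simp_all add: sum_distrib_left sum.distrib)

text \<open>The value is a finite combination of values of \<open>f\<close> at sublists of
  \<open>L\<close>, so convergence at these lists is enough.\<close>

lemma absorb_sums:
  fixes w :: "('x \<Rightarrow> 'f::real_normed_field) \<Rightarrow> 'f"
  assumes "\<And>M. M \<in> lists T \<Longrightarrow> length M \<le> length L \<Longrightarrow> (\<lambda>m. f m M) sums F M" "L \<in> lists T"
  shows "(\<lambda>m. absorb w \<phi> L (f m)) sums absorb w \<phi> L F"
  using assms
proof (induction L arbitrary: \<phi> f F)
  case (Cons \<xi> L)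
  have "(\<lambda>m. absorb w \<phi> L (\<lambda>M. f m (\<xi> # M))) sums absorb w \<phi> L (\<lambda>M. F (\<xi> # M))" for \<phi>
    by (rule Cons.IH) (use Cons.prems in auto)
  moreover have "(\<lambda>m. absorb w \<phi> L (f m)) sums absorb w \<phi> L F" for \<phi>
    by (rule Cons.IH) (use Cons.prems in auto)
  ultimately show ?case by (simp add: sums_add)
qed (auto intro: sums_mult)

text \<open>Each value is determined by values at strictly shorter lists. The products formed by
  \<open>absorb\<close> only enter \<open>w\<close>, so the arguments of \<mu> and \<nu> stay in
  \<open>lists T\<close>.\<close>

lemma absorb_recursion_unique:
  assumes "\<mu> [] = \<nu> []"
    and "\<And>\<phi> L. \<phi> \<in> T \<Longrightarrow> L \<in> lists T \<Longrightarrow> \<mu> (\<phi> # L) = absorb w \<phi> L \<mu>"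
    and "\<And>\<phi> L. \<phi> \<in> T \<Longrightarrow> L \<in> lists T \<Longrightarrow> \<nu> (\<phi> # L) = absorb w \<phi> L \<nu>"
    and "L \<in> lists T"
  shows "\<mu> L = \<nu> L"
  using assms(4)
proof (induction L rule: length_induct)
  case (1 L)
  show ?case
  proof (cases L)
    case (Cons \<phi> M)
    then show ?thesis
      using 1 assms(2,3) by (auto simp: less_Suc_eq_le intro!: absorb_cong[where T = T])
  qed (use assms(1) in simp)
qed

text \<open>
  The value of the \<open>m\<close>-fold tensor power of \<open>w\<close> at the function
  \<open>x \<mapsto> (\<Prod>j<m. h j (x j)) * (\<Prod>\<xi>\<leftarrow>L. \<Sum>j<m. \<xi> (x j))\<close>, multiplied out.
\<close>

primrec tensor_eval ::
  "(('x \<Rightarrow> 'f::comm_ring_1) \<Rightarrow> 'f) \<Rightarrow> nat \<Rightarrow> ('x \<Rightarrow> 'f) list \<Rightarrow> (nat \<Rightarrow> 'x \<Rightarrow> 'f) \<Rightarrow> 'f"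
where
  "tensor_eval w m [] h = (\<Prod>j<m. w (h j))"
| "tensor_eval w m (\<xi> # L) h = (\<Sum>j<m. tensor_eval w m L (h(j := \<lambda>x. h j x * \<xi> x)))"

lemma tensor_eval_cong:
  "(\<And>j. j < m \<Longrightarrow> h j = h' j) \<Longrightarrow> tensor_eval w m L h = tensor_eval w m L h'"
proof (induction L arbitrary: h h')
  case (Cons \<xi> L)
  show ?case
    unfolding tensor_eval.simps by (intro sum.cong refl Cons.IH) (use Cons.prems in auto)
qed simp

lemma tensor_eval_permute:
  assumes "\<pi> permutes {..<m}"
  shows "tensor_eval w m L (h \<circ> \<pi>) = tensor_eval w m L h"
proof (induction L arbitrary: h)
  case Nil
  show ?case
    using prod.permute[OF assms, of "\<lambda>j. w (h j)"] by (simp add: comp_def)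
next
  case (Cons \<xi> L)
  \<comment> \<open>Multiplying coordinate j of the permuted family means multiplying coordinate
    \<pi> j of \<open>h\<close>, so the sum over j is merely reindexed.\<close>
  have upd: "(h \<circ> \<pi>)(j := \<lambda>x. (h \<circ> \<pi>) j x * \<xi> x) = h(\<pi> j := \<lambda>x. h (\<pi> j) x * \<xi> x) \<circ> \<pi>" for j
    using permutes_inj[OF assms] by (auto simp: fun_eq_iff inj_eq)
  have "tensor_eval w m (\<xi> # L) (h \<circ> \<pi>) =
      (\<Sum>j<m. tensor_eval w m L (h(\<pi> j := \<lambda>x. h (\<pi> j) x * \<xi> x)))"
    unfolding tensor_eval.simps upd Cons.IH ..
  also have "\<dots> = tensor_eval w m (\<xi> # L) h"
    using sum.permute[OF assms, of "\<lambda>j. tensor_eval w m L (h(j := \<lambda>x. h j x * \<xi> x))"]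
    by (simp add: comp_def)
  finally show ?case .
qed

text \<open>Splits off the last coordinate. Each \<xi> in \<open>L\<close> falls either on one of
  the first m coordinates, where it stays in the list, or on coordinate m, where it multiplies
  \<open>h m\<close>; this is the branching of \<open>absorb\<close>.\<close>

lemma tensor_eval_Suc:
  "tensor_eval w (Suc m) L h = absorb w (h m) L (\<lambda>M. tensor_eval w m M h)"
proof (induction L arbitrary: h)
  case (Cons \<xi> L)
  let ?u = "\<lambda>j. h(j := \<lambda>x. h j x * \<xi> x)"
  have "tensor_eval w (Suc m) (\<xi> # L) h =
      (\<Sum>j<m. absorb w (?u j m) L (\<lambda>M. tensor_eval w m M (?u j))) +
      absorb w (?u m m) L (\<lambda>M. tensor_eval w m M (?u m))"
    by (simp add: Cons.IH fun_upd_def)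
  also have "(\<Sum>j<m. absorb w (?u j m) L (\<lambda>M. tensor_eval w m M (?u j))) =
      (\<Sum>j<m. absorb w (h m) L (\<lambda>M. tensor_eval w m M (?u j)))"
    by (intro sum.cong) auto
  also have "\<dots> = absorb w (h m) L (\<lambda>M. tensor_eval w m (\<xi> # M) h)"
    by (simp add: absorb_sum)
  \<comment> \<open>Only the coordinates below m are read, so the update at m is invisible.\<close>
  also have "(\<lambda>M. tensor_eval w m M (?u m)) = (\<lambda>M. tensor_eval w m M h)"
    by (intro ext tensor_eval_cong) auto
  finally show ?case by simp
qed simp

text \<open>
  The Mecke identity: the \<open>Suc m\<close> coordinates that can carry \<open>\<phi>\<close> contribute equally, which turns
  \<open>inverse (fact (Suc m))\<close> into \<open>inverse (fact m)\<close>.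
\<close>

lemma tensor_eval_Cons_Suc:
  assumes "(\<lambda>x. e x * \<phi> x) = \<phi>"
  shows "tensor_eval w (Suc m) (\<phi> # L) (\<lambda>_. e) =
    of_nat (Suc m) * absorb w \<phi> L (\<lambda>M. tensor_eval w m M (\<lambda>_. e))"
proof -
  have "tensor_eval w (Suc m) L ((\<lambda>_. e)(j := \<phi>)) = absorb w \<phi> L (\<lambda>M. tensor_eval w m M (\<lambda>_. e))"
    if "j < Suc m" for j
  proof -
    \<comment> \<open>By symmetry \<phi> may sit on the last coordinate, the one that
      \<open>tensor_eval_Suc\<close> splits off.\<close>
    have "Transposition.transpose j m permutes {..<Suc m}"
      using that by (intro permutes_swap_id) auto
    moreover have "(\<lambda>_. e)(j := \<phi>) = (\<lambda>_. e)(m := \<phi>) \<circ> Transposition.transpose j m"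
      by (auto simp: fun_eq_iff Transposition.transpose_def)
    ultimately have "tensor_eval w (Suc m) L ((\<lambda>_. e)(j := \<phi>)) =
        tensor_eval w (Suc m) L ((\<lambda>_. e)(m := \<phi>))"
      by (simp only: tensor_eval_permute)
    also have "\<dots> = absorb w \<phi> L (\<lambda>M. tensor_eval w m M ((\<lambda>_. e)(m := \<phi>)))"
      by (simp add: tensor_eval_Suc)
    also have "(\<lambda>M. tensor_eval w m M ((\<lambda>_. e)(m := \<phi>))) = (\<lambda>M. tensor_eval w m M (\<lambda>_. e))"
      by (intro ext tensor_eval_cong) auto
    finally show ?thesis .
  qed
  then have "(\<Sum>j<Suc m. tensor_eval w (Suc m) L ((\<lambda>_. e)(j := \<phi>))) =
      of_nat (Suc m) * absorb w \<phi> L (\<lambda>M. tensor_eval w m M (\<lambda>_. e))"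
    by simp
  then show ?thesis
    by (simp only: tensor_eval.simps assms)
qed

text \<open>The Poisson series without its normalization; \<open>e\<close> plays the indicator of
  the region and acts as a unit on \<open>T\<close>. Summability comes along with the recursion:
  after an index shift, the series at \<open>\<phi> # L\<close> is a finite combination of series at
  shorter lists, and at the empty list it is the exponential series.\<close>

lemma tensor_eval_series:
  fixes w :: "('x \<Rightarrow> 'f::{real_normed_field,banach}) \<Rightarrow> 'f"
  assumes "\<And>\<phi>. \<phi> \<in> T \<Longrightarrow> (\<lambda>x. e x * \<phi> x) = \<phi>"
  defines "F \<equiv> \<lambda>L. \<Sum>m. inverse (fact m) * tensor_eval w m L (\<lambda>_. e)"
  shows tensor_eval_series_Nil: "F [] = exp (w e)"
    and tensor_eval_series_Cons: "\<phi> \<in> T \<Longrightarrow> L \<in> lists T \<Longrightarrow> F (\<phi> # L) = absorb w \<phi> L F"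
proof -
  let ?t = "\<lambda>L m. inverse (fact m) * tensor_eval w m L (\<lambda>_. e)"
  have Nil: "?t [] sums exp (w e)"
    using exp_converges[of "w e"] by (simp add: scaleR_conv_of_real of_real_inverse)
  have step: "?t (\<phi> # L) sums absorb w \<phi> L G"
    if "\<phi> \<in> T" "L \<in> lists T" "\<And>M. M \<in> lists T \<Longrightarrow> length M \<le> length L \<Longrightarrow> ?t M sums G M" for \<phi> L G
  proof -
    have "?t (\<phi> # L) (Suc m) = absorb w \<phi> L (\<lambda>M. ?t M m)" for m
    proof -
      have "inverse (fact (Suc m) :: 'f) * of_nat (Suc m) = inverse (fact m)"
        by (simp add: field_simps del: of_nat_Suc)
      then show ?thesis
        by (simp only: tensor_eval_Cons_Suc[OF assms(1)[OF that(1)]] absorb_cmult mult.assoc[symmetric])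
    qed
    moreover have "(\<lambda>m. absorb w \<phi> L (\<lambda>M. ?t M m)) sums absorb w \<phi> L G"
      by (rule absorb_sums) (use that in auto)
    \<comment> \<open>With no coordinate to carry \<phi> the sum is empty, so the index shift loses
      nothing.\<close>
    moreover have "?t (\<phi> # L) 0 = 0"
      by simp
    ultimately show ?thesis
      using sums_Suc_iff[of "?t (\<phi> # L)" "absorb w \<phi> L G"] by simp
  qed
  have summable: "?t L sums F L" if "L \<in> lists T" for L
    using that
  proof (induction L rule: length_induct)
    case (1 L)
    show ?case
    proof (cases L)
      case Nil
      then show ?thesis
        using \<open>?t [] sums _\<close> by (simp only: F_def sums_unique[symmetric])
    next
      case (Cons \<phi> M)
      then have "?t (\<phi> # M) sums absorb w \<phi> M F"
        using 1 by (intro step) (auto simp: less_Suc_eq_le)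
      then show ?thesis
        unfolding Cons F_def by (simp only: sums_iff)
    qed
  qed
  show "F [] = exp (w e)"
    unfolding F_def by (rule sums_unique[OF Nil, symmetric])
  show "F (\<phi> # L) = absorb w \<phi> L F" if "\<phi> \<in> T" "L \<in> lists T"
    using sums_unique[OF step[OF that summable]] by (simp only: F_def)
qed

section \<open>Normal ordering and the vacuum functional\<close>

definition word :: "('g \<Rightarrow> 'v \<Rightarrow> 'v) \<Rightarrow> 'g list \<Rightarrow> 'v \<Rightarrow> 'v" where
  "word c l = foldr (\<circ>) (map c l) id"

lemma word_Nil [simp]: "word c [] = id"
  and word_Cons [simp]: "word c (\<phi> # l) = c \<phi> \<circ> word c l"
  by (simp_all add: word_def)

lemma word_append: "word c (l @ l') = word c l \<circ> word c l'"
  by (induction l) (simp_all add: comp_assoc)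

inductive_set operator_span :: "('f \<Rightarrow> 'v::ab_group_add \<Rightarrow> 'v) \<Rightarrow> ('v \<Rightarrow> 'v) set \<Rightarrow> ('v \<Rightarrow> 'v) set"
  for smul :: "'f \<Rightarrow> 'v \<Rightarrow> 'v" and B :: "('v \<Rightarrow> 'v) set"
where
  base: "T \<in> B \<Longrightarrow> T \<in> operator_span smul B"
| add: "S \<in> operator_span smul B \<Longrightarrow> T \<in> operator_span smul B \<Longrightarrow>
    (\<lambda>v. S v + T v) \<in> operator_span smul B"
| smult: "T \<in> operator_span smul B \<Longrightarrow> (\<lambda>v. smul c (T v)) \<in> operator_span smul B"

lemma operator_span_mono: "B \<subseteq> C \<Longrightarrow> operator_span smul B \<subseteq> operator_span smul C"
proof
  show "T \<in> operator_span smul C" if "B \<subseteq> C" "T \<in> operator_span smul B" for T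
    using that(2,1) by induction (auto intro: operator_span.intros)
qed

lemma operator_span_comp_right:
  assumes "S \<in> operator_span smul B" "\<And>X. X \<in> B \<Longrightarrow> X \<circ> T \<in> operator_span smul C"
  shows "S \<circ> T \<in> operator_span smul C"
  using assms(1)
  by induction (use assms(2) in \<open>auto simp: comp_def intro: operator_span.intros\<close>)

lemma operator_span_comp_left:
  assumes "S \<in> operator_span smul B" "\<And>X. X \<in> B \<Longrightarrow> T \<circ> X \<in> operator_span smul C"
    and "Vector_Spaces.linear smul smul T"
  shows "T \<circ> S \<in> operator_span smul C"
proof -
  have [simp]: "T (u + v) = T u + T v" "T (smul c v) = smul c (T v)" for u v c
    using assms(3) by (auto simp: Vector_Spaces.linear_iff)
  show ?thesis
    using assms(1)
    by induction (use assms(2) in \<open>auto simp: comp_def intro: operator_span.intros\<close>)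
qed

context current_operators
begin

abbreviation "\<A> \<equiv> current_algebra smul ap am rho"
abbreviation "R \<equiv> field_operator smul \<sigma> ap am rho"

lemma ap_linear: "\<phi> \<in> test_functions \<Longrightarrow> Vector_Spaces.linear smul smul (ap \<phi>)"
  and am_linear: "\<phi> \<in> test_functions \<Longrightarrow> Vector_Spaces.linear smul smul (am \<phi>)"
  and rho_linear: "\<phi> \<in> test_functions \<Longrightarrow> Vector_Spaces.linear smul smul (rho \<phi>)"
  using lin_ap lin_am lin_rho by (auto simp: linear_operator_family_def)

lemma ap_in [intro]: "\<phi> \<in> test_functions \<Longrightarrow> ap \<phi> \<in> \<A>"
  and am_in [intro]: "\<phi> \<in> test_functions \<Longrightarrow> am \<phi> \<in> \<A>"
  and rho_in [intro]: "\<phi> \<in> test_functions \<Longrightarrow> rho \<phi> \<in> \<A>"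
  and id_in [intro]: "id \<in> \<A>"
  and add_in [intro]: "S \<in> \<A> \<Longrightarrow> T \<in> \<A> \<Longrightarrow> (\<lambda>v. S v + T v) \<in> \<A>"
  and smult_in [intro]: "S \<in> \<A> \<Longrightarrow> (\<lambda>v. smul c (S v)) \<in> \<A>"
  and comp_in [intro]: "S \<in> \<A> \<Longrightarrow> T \<in> \<A> \<Longrightarrow> S \<circ> T \<in> \<A>"
  unfolding current_algebra_def by (auto intro: generated_algebra.intros)

lemma word_in: "(\<And>\<phi>. \<phi> \<in> set l \<Longrightarrow> c \<phi> \<in> \<A>) \<Longrightarrow> word c l \<in> \<A>"
  by (induction l) auto

lemma field_operator_in: "\<phi> \<in> test_functions \<Longrightarrow> R \<phi> \<in> \<A>"
  using smult_in[OF id_in] by (auto simp: field_operator_def intro!: add_in)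

lemma algebra_linear: "T \<in> \<A> \<Longrightarrow> Vector_Spaces.linear smul smul T"
  unfolding current_algebra_def
proof (induction rule: generated_algebra.induct)
  case one
  show ?case using linear_id by (simp add: id_def)
next
  case (gen T)
  then show ?case using ap_linear am_linear rho_linear by auto
next
  case (mult S T)
  then show ?case using Vector_Spaces.linear_compose by blast
qed (auto simp: Vector_Spaces.linear_iff scale_right_distrib mult.commute ac_simps)

lemma algebra_add: "T \<in> \<A> \<Longrightarrow> T (u + v) = T u + T v"
  and algebra_scale: "T \<in> \<A> \<Longrightarrow> T (smul c v) = smul c (T v)"
  using algebra_linear[of T] by (simp_all add: Vector_Spaces.linear_iff)

lemma ap_comm: "\<phi> \<in> test_functions \<Longrightarrow> \<psi> \<in> test_functions \<Longrightarrow> ap \<phi> \<circ> ap \<psi> = ap \<psi> \<circ> ap \<phi>"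
  and am_comm: "\<phi> \<in> test_functions \<Longrightarrow> \<psi> \<in> test_functions \<Longrightarrow> am \<phi> \<circ> am \<psi> = am \<psi> \<circ> am \<phi>"
  and rho_comm: "\<phi> \<in> test_functions \<Longrightarrow> \<psi> \<in> test_functions \<Longrightarrow> rho \<phi> \<circ> rho \<psi> = rho \<psi> \<circ> rho \<phi>"
  using ap_ap[of \<phi> \<psi>] am_am[of \<phi> \<psi>] rho_rho[of \<phi> \<psi>]
  by (simp_all add: commutator_def fun_eq_iff)

lemma rho_ap_swap:
  assumes "\<phi> \<in> test_functions" "\<xi> \<in> test_functions"
  shows "rho \<phi> (ap \<xi> v) = ap \<xi> (rho \<phi> v) + ap (\<lambda>x. \<phi> x * \<xi> x) v"
  using fun_cong[OF rho_ap[OF assms], of v] by (simp add: commutator_def algebra_simps)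

lemma am_rho_swap:
  assumes "\<phi> \<in> test_functions" "\<xi> \<in> test_functions"
  shows "am \<xi> (rho \<phi> v) = rho \<phi> (am \<xi> v) + am (\<lambda>x. \<phi> x * \<xi> x) v"
  using fun_cong[OF am_rho[OF assms], of v] by (simp add: commutator_def algebra_simps)

lemma am_ap_swap:
  assumes "\<phi> \<in> test_functions" "\<xi> \<in> test_functions"
  shows "am \<phi> (ap \<xi> v) = ap \<xi> (am \<phi> v) + smul (pairing \<sigma> (\<lambda>x. \<phi> x * \<xi> x)) v"
  using fun_cong[OF am_ap[OF assms], of v] by (simp add: commutator_def algebra_simps)

section \<open>Normally ordered monomials span the algebra\<close>

definition monomial :: "('x \<Rightarrow> 'f) list \<Rightarrow> ('x \<Rightarrow> 'f) list \<Rightarrow> ('x \<Rightarrow> 'f) list \<Rightarrow> 'v \<Rightarrow> 'v" where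
  "monomial a b c = word ap a \<circ> word rho b \<circ> word am c"

definition monomials :: "('v \<Rightarrow> 'v) set" where
  "monomials = {monomial a b c | a b c.
     a \<in> lists test_functions \<and> b \<in> lists test_functions \<and> c \<in> lists test_functions}"

text \<open>The multilinear counterpart of the operators that the vacuum functional kills. The
  condition is put on the lists of factors because no linear independence of the monomials is
  known.\<close>

definition nontrivial_monomials :: "('v \<Rightarrow> 'v) set" where
  "nontrivial_monomials = {monomial a b c | a b c.
     a \<in> lists test_functions \<and> b \<in> lists test_functions \<and> c \<in> lists test_functions \<and>
     (a, b, c) \<noteq> ([], [], [])}"

abbreviation "normal \<equiv> operator_span smul monomials"
abbreviation "normal0 \<equiv> operator_span smul nontrivial_monomials"

lemma normal0_normal: "T \<in> normal0 \<Longrightarrow> T \<in> normal"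
proof -
  have "nontrivial_monomials \<subseteq> monomials"
    unfolding monomials_def nontrivial_monomials_def by blast
  then show "T \<in> normal0 \<Longrightarrow> T \<in> normal"
    using operator_span_mono by blast
qed

lemma monomial_normal:
  "a \<in> lists test_functions \<Longrightarrow> b \<in> lists test_functions \<Longrightarrow> c \<in> lists test_functions \<Longrightarrow>
    monomial a b c \<in> normal"
  by (rule operator_span.base) (unfold monomials_def, blast)

lemma monomial_normal0:
  "a \<in> lists test_functions \<Longrightarrow> b \<in> lists test_functions \<Longrightarrow> c \<in> lists test_functions \<Longrightarrow>
    (a, b, c) \<noteq> ([], [], []) \<Longrightarrow> monomial a b c \<in> normal0"
  by (rule operator_span.base) (unfold nontrivial_monomials_def, blast)

lemma monomialsE:
  assumes "X \<in> monomials"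
  obtains a b c where "X = monomial a b c" "a \<in> lists test_functions"
    "b \<in> lists test_functions" "c \<in> lists test_functions"
  using assms unfolding monomials_def by blast

lemma monomial_in: "T \<in> monomials \<Longrightarrow> T \<in> \<A>"
  by (auto elim!: monomialsE simp: monomial_def intro!: comp_in word_in ap_in am_in rho_in)

lemma normal_in: "T \<in> normal \<Longrightarrow> T \<in> \<A>"
  by (induction rule: operator_span.induct) (auto intro: monomial_in)

lemma ap_normal:
  assumes "T \<in> normal" "\<phi> \<in> test_functions"
  shows "ap \<phi> \<circ> T \<in> normal0"
proof (rule operator_span_comp_left[OF assms(1) _ ap_linear[OF assms(2)]])
  fix X assume "X \<in> monomials"
  then obtain a b c where X: "X = monomial a b c" "a \<in> lists test_functions"
      "b \<in> lists test_functions" "c \<in> lists test_functions"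
    by (rule monomialsE)
  then have "ap \<phi> \<circ> X = monomial (\<phi> # a) b c"
    by (simp add: monomial_def comp_assoc)
  then show "ap \<phi> \<circ> X \<in> normal0"
    using X assms(2) by (simp add: monomial_normal0)
qed

lemma normal_am:
  assumes "T \<in> normal" "\<phi> \<in> test_functions"
  shows "T \<circ> am \<phi> \<in> normal0"
proof (rule operator_span_comp_right[OF assms(1)])
  fix X assume "X \<in> monomials"
  then obtain a b c where X: "X = monomial a b c" "a \<in> lists test_functions"
      "b \<in> lists test_functions" "c \<in> lists test_functions"
    by (rule monomialsE)
  then have "X \<circ> am \<phi> = monomial a b (c @ [\<phi>])"
    by (simp add: monomial_def comp_assoc word_append)
  then show "X \<circ> am \<phi> \<in> normal0"
    using X assms(2) by (simp add: monomial_normal0)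
qed

text \<open>Passing a creation operator replaces it by another one, a^+(\<psi> \<phi>). No factor is
  lost, so the empty monomial never appears and the result stays in \<open>normal0\<close>.\<close>

lemma rho_monomial:
  assumes "\<psi> \<in> test_functions" "a \<in> lists test_functions" "b \<in> lists test_functions"
    "c \<in> lists test_functions"
  shows "rho \<psi> \<circ> monomial a b c \<in> normal0"
  using assms(2)
proof (induction a)
  case Nil
  have "rho \<psi> \<circ> monomial [] b c = monomial [] (\<psi> # b) c"
    by (simp add: monomial_def comp_assoc)
  then show ?case
    using assms by (simp add: monomial_normal0)
next
  case (Cons \<phi> a)
  let ?X = "monomial a b c"
  have "monomial (\<phi> # a) b c = ap \<phi> \<circ> ?X"
    by (simp add: monomial_def comp_assoc)
  then have eq: "rho \<psi> \<circ> monomial (\<phi> # a) b c =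
      (\<lambda>v. (ap \<phi> \<circ> (rho \<psi> \<circ> ?X)) v + (ap (\<lambda>x. \<psi> x * \<phi> x) \<circ> ?X) v)"
    using Cons.hyps assms(1) by (simp add: fun_eq_iff rho_ap_swap)
  have "?X \<in> normal"
    using Cons.hyps assms by (simp add: monomial_normal)
  then show ?case
    unfolding eq using Cons.hyps Cons.IH assms(1)
    by (intro operator_span.add ap_normal test_functions_mult normal0_normal[OF Cons.IH])
qed

lemma rho_normal:
  assumes "T \<in> normal" "\<psi> \<in> test_functions"
  shows "rho \<psi> \<circ> T \<in> normal0"
  by (rule operator_span_comp_left[OF assms(1) _ rho_linear[OF assms(2)]])
    (auto elim!: monomialsE intro!: rho_monomial assms(2))

text \<open>The correction from passing \<rho>(\<psi>) is again an annihilation operator, but with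
  argument \<psi> \<xi>; hence the induction for arbitrary \<xi>.\<close>

lemma am_monomial_rho:
  assumes "\<xi> \<in> test_functions" "b \<in> lists test_functions" "c \<in> lists test_functions"
  shows "am \<xi> \<circ> monomial [] b c \<in> normal"
  using assms(2,1)
proof (induction b arbitrary: \<xi>)
  case Nil
  have "am \<xi> \<circ> monomial [] [] c = monomial [] [] (\<xi> # c)"
    by (simp add: monomial_def comp_assoc)
  then show ?case
    using Nil assms by (simp add: monomial_normal)
next
  case (Cons \<psi> b)
  let ?X = "monomial [] b c"
  have "monomial [] (\<psi> # b) c = rho \<psi> \<circ> ?X"
    by (simp add: monomial_def comp_assoc)
  then have eq: "am \<xi> \<circ> monomial [] (\<psi> # b) c =
      (\<lambda>v. (rho \<psi> \<circ> (am \<xi> \<circ> ?X)) v + (am (\<lambda>x. \<psi> x * \<xi> x) \<circ> ?X) v)"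
    using Cons.hyps Cons.prems by (simp add: fun_eq_iff am_rho_swap)
  show ?case
    unfolding eq
    by (intro operator_span.add normal0_normal[OF rho_normal] Cons.IH test_functions_mult
        Cons.hyps(1) Cons.prems)
qed

text \<open>Passing a creation operator leaves a scalar multiple of a shorter monomial, possibly the
  empty one. This is why only \<open>normal\<close> is reached here, and it is the source of nonzero
  vacuum expectations.\<close>

lemma am_monomial:
  assumes "\<xi> \<in> test_functions" "a \<in> lists test_functions" "b \<in> lists test_functions"
    "c \<in> lists test_functions"
  shows "am \<xi> \<circ> monomial a b c \<in> normal"
  using assms(2)
proof (induction a)
  case Nil
  show ?case using assms by (intro am_monomial_rho)
next
  case (Cons \<phi> a)
  let ?X = "monomial a b c"
  have "monomial (\<phi> # a) b c = ap \<phi> \<circ> ?X"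
    by (simp add: monomial_def comp_assoc)
  then have eq: "am \<xi> \<circ> monomial (\<phi> # a) b c =
      (\<lambda>v. (ap \<phi> \<circ> (am \<xi> \<circ> ?X)) v + smul (pairing \<sigma> (\<lambda>x. \<xi> x * \<phi> x)) (?X v))"
    using Cons.hyps assms(1) by (simp add: fun_eq_iff am_ap_swap)
  have "?X \<in> normal"
    using Cons.hyps assms by (simp add: monomial_normal)
  then show ?case
    unfolding eq
    by (intro operator_span.add operator_span.smult normal0_normal[OF ap_normal] Cons.IH Cons.hyps(1))
qed

lemma am_normal:
  assumes "T \<in> normal" "\<psi> \<in> test_functions"
  shows "am \<psi> \<circ> T \<in> normal"
  by (rule operator_span_comp_left[OF assms(1) _ am_linear[OF assms(2)]])
    (auto elim!: monomialsE intro!: am_monomial assms(2))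

text \<open>A strengthening of \<open>algebra_normal\<close>, which is the case of the identity:
  with an arbitrary normal right factor, the product case is two uses of the induction hypothesis,
  and no product of two normal operators has to be reordered.\<close>

lemma algebra_comp_normal: "T \<in> \<A> \<Longrightarrow> S \<in> normal \<Longrightarrow> T \<circ> S \<in> normal"
  unfolding current_algebra_def
proof (induction T arbitrary: S rule: generated_algebra.induct)
  case (gen T)
  then show ?case
    using ap_normal am_normal rho_normal normal0_normal by blast
next
  case (add T T')
  then show ?case
    using operator_span.add[OF add.IH] by (simp add: comp_def)
next
  case (smult T c)
  then show ?case
    using operator_span.smult[OF smult.IH] by (simp add: comp_def)
next
  case (mult T T')
  then show ?case by (simp only: comp_assoc)
qed simp

lemma algebra_normal:
  assumes "T \<in> \<A>"
  shows "T \<in> normal"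
proof -
  have "id \<in> normal"
    using monomial_normal[of "[]" "[]" "[]"] by (simp add: monomial_def)
  from algebra_comp_normal[OF assms this] show ?thesis by simp
qed

section \<open>Polarization of the vacuum functional\<close>

context
  fixes \<tau> :: "('v \<Rightarrow> 'v) \<Rightarrow> 'f"
  assumes \<tau>: "vacuum_functional smul ap am rho \<tau>"
begin

lemma vacuum_add: "S \<in> \<A> \<Longrightarrow> T \<in> \<A> \<Longrightarrow> \<tau> (\<lambda>v. S v + T v) = \<tau> S + \<tau> T"
  and vacuum_smult: "S \<in> \<A> \<Longrightarrow> \<tau> (\<lambda>v. smul c (S v)) = c * \<tau> S"
  and vacuum_id: "\<tau> id = 1"
  using \<tau> by (simp_all add: vacuum_functional_def)

lemma vacuum_powers:
  "\<phi> \<in> test_functions \<Longrightarrow> \<psi> \<in> test_functions \<Longrightarrow> \<xi> \<in> test_functions \<Longrightarrow>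
    i + j + k \<ge> 1 \<Longrightarrow> \<tau> ((ap \<phi> ^^ i) \<circ> (rho \<psi> ^^ j) \<circ> (am \<xi> ^^ k)) = 0"
  using \<tau> unfolding vacuum_functional_def by (elim conjE) (simp only:)

lemma funpow_in: "A \<in> \<A> \<Longrightarrow> A ^^ n \<in> \<A>"
  by (induction n) auto

text \<open>Expands \<tau> of (A + t B)^n as a polynomial in t, as far as polarization needs it: the
  n first-order terms coincide because A and B commute. \<open>Y\<close> varies in the induction
  since it takes up the factor A + t B peeled off next to it.\<close>

lemma vacuum_binomial:
  assumes A: "A \<in> \<A>" and B: "B \<in> \<A>" and AB: "A \<circ> B = B \<circ> A" and X: "X \<in> \<A>" and Y: "Y \<in> \<A>"
  shows "\<exists>q. (\<forall>t. \<tau> (X \<circ> ((\<lambda>v. A v + smul t (B v)) ^^ n) \<circ> Y) = poly q t) \<and>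
    coeff q 0 = \<tau> (X \<circ> (A ^^ n) \<circ> Y) \<and>
    coeff q 1 = of_nat n * \<tau> (X \<circ> (A ^^ (n - 1)) \<circ> B \<circ> Y)"
  using Y
proof (induction n arbitrary: Y)
  case 0
  show ?case by (intro exI[of _ "[:\<tau> (X \<circ> Y):]"]) (simp add: comp_def)
next
  case (Suc n)
  let ?C = "\<lambda>t v. A v + smul t (B v)"
  obtain p where p: "\<And>t. \<tau> (X \<circ> (?C t ^^ n) \<circ> (A \<circ> Y)) = poly p t"
      "coeff p 0 = \<tau> (X \<circ> (A ^^ n) \<circ> (A \<circ> Y))"
      "coeff p 1 = of_nat n * \<tau> (X \<circ> (A ^^ (n - 1)) \<circ> B \<circ> (A \<circ> Y))"
    using Suc.IH[OF comp_in[OF A Suc.prems]] by blast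
  obtain q where q: "\<And>t. \<tau> (X \<circ> (?C t ^^ n) \<circ> (B \<circ> Y)) = poly q t"
      "coeff q 0 = \<tau> (X \<circ> (A ^^ n) \<circ> (B \<circ> Y))"
    using Suc.IH[OF comp_in[OF B Suc.prems]] by blast
  have C: "?C t \<in> \<A>" for t
    using A B by auto
  \<comment> \<open>\<open>p + pCons 0 q\<close> is p(t) + t q(t): the last factor contributes A to
    the first summand and t B to the second.\<close>
  have "\<tau> (X \<circ> (?C t ^^ Suc n) \<circ> Y) = poly (p + pCons 0 q) t" for t
  proof -
    let ?Z = "X \<circ> (?C t ^^ n)"
    have Z: "?Z \<in> \<A>"
      using X funpow_in[OF C] by auto
    have "X \<circ> (?C t ^^ Suc n) \<circ> Y = (\<lambda>v. (?Z \<circ> (A \<circ> Y)) v + smul t ((?Z \<circ> (B \<circ> Y)) v))"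
      using algebra_add[OF Z] algebra_scale[OF Z] by (simp add: fun_eq_iff funpow_Suc_right del: funpow.simps)
    moreover have "?Z \<circ> (A \<circ> Y) \<in> \<A>" "?Z \<circ> (B \<circ> Y) \<in> \<A>"
      using Z A B Suc.prems by blast+
    ultimately have "\<tau> (X \<circ> (?C t ^^ Suc n) \<circ> Y) = \<tau> (?Z \<circ> (A \<circ> Y)) + t * \<tau> (?Z \<circ> (B \<circ> Y))"
      by (simp only: vacuum_add vacuum_smult smult_in)
    then show ?thesis
      by (simp only: p q poly_add poly_pCons add_0)
  qed
  moreover have "coeff (p + pCons 0 q) 0 = \<tau> (X \<circ> (A ^^ Suc n) \<circ> Y)"
    using p(2) by (simp add: comp_assoc funpow_Suc_right del: funpow.simps)
  moreover have "coeff (p + pCons 0 q) 1 = of_nat (Suc n) * \<tau> (X \<circ> (A ^^ (Suc n - 1)) \<circ> B \<circ> Y)"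
  \<comment> \<open>For n = 0 the exponent \<open>n - 1\<close> is truncated, but then
    \<open>coeff p 1\<close> carries the factor 0.\<close>
  proof (cases n)
    case (Suc k)
    have "(A ^^ (n - 1)) \<circ> B \<circ> (A \<circ> Y) = (A ^^ n) \<circ> B \<circ> Y"
      unfolding Suc using AB by (simp add: funpow_Suc_right fun_eq_iff del: funpow.simps)
    then have "X \<circ> (A ^^ (n - 1)) \<circ> B \<circ> (A \<circ> Y) = X \<circ> (A ^^ n) \<circ> B \<circ> Y"
      by (simp add: comp_assoc)
    then show ?thesis
      using p(3) q(2) by (simp add: comp_assoc algebra_simps)
  qed (use p(3) q(2) in \<open>simp add: comp_assoc\<close>)
  ultimately show ?case by blast
qed

text \<open>Passes from powers to words in one slot, with the other slots held in \<open>X\<close>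
  and \<open>Y\<close>. Replacing \<psi> by \<psi> + t \<eta> in a power and reading off the
  coefficient of t turns one factor into c(\<eta>).\<close>

lemma vacuum_polarization:
  fixes c :: "('x \<Rightarrow> 'f) \<Rightarrow> 'v \<Rightarrow> 'v"
  assumes c: "linear_operator_family smul c" "\<And>\<phi>. \<phi> \<in> test_functions \<Longrightarrow> c \<phi> \<in> \<A>"
    and comm: "\<And>\<phi> \<psi>. \<phi> \<in> test_functions \<Longrightarrow> \<psi> \<in> test_functions \<Longrightarrow> c \<phi> \<circ> c \<psi> = c \<psi> \<circ> c \<phi>"
    and X: "X \<in> \<A>" and Y: "Y \<in> \<A>"
    and diag: "\<And>\<phi>. \<phi> \<in> test_functions \<Longrightarrow> \<tau> (X \<circ> (c \<phi> ^^ length l) \<circ> Y) = 0"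
    and l: "l \<in> lists test_functions"
  shows "\<tau> (X \<circ> word c l \<circ> Y) = 0"
proof -
  \<comment> \<open>Interpolates between the pure power (\<open>l'\<close> empty) and the full word
    (k = 0); each step trades a letter of \<open>l'\<close> for one more equal factor.\<close>
  have "\<tau> (X \<circ> (c \<psi> ^^ k) \<circ> (word c l' \<circ> Y)) = 0"
    if "length l' + k = length l" "l' \<in> lists test_functions" "\<psi> \<in> test_functions" for l' k \<psi>
    using that(2,1,3)
  proof (induction l' arbitrary: k \<psi>)
    case Nil
    then show ?case using diag[of \<psi>] by (simp add: comp_def)
  next
    case (Cons \<eta> l')
    have Y': "word c l' \<circ> Y \<in> \<A>"
      using Cons.hyps Y c(2) by (auto intro!: word_in)
    obtain q where q: "\<And>t. \<tau> (X \<circ> ((\<lambda>v. c \<psi> v + smul t (c \<eta> v)) ^^ Suc k) \<circ> (word c l' \<circ> Y)) = poly q t"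
        "coeff q 1 = of_nat (Suc k) * \<tau> (X \<circ> (c \<psi> ^^ (Suc k - 1)) \<circ> c \<eta> \<circ> (word c l' \<circ> Y))"
      using vacuum_binomial[OF c(2)[OF Cons.prems(2)] c(2)[OF Cons.hyps(1)]
          comm[OF Cons.prems(2) Cons.hyps(1)] X Y', of "Suc k"] by blast
    have "poly q t = 0" for t
    proof -
      have t: "(\<lambda>x. \<psi> x + t * \<eta> x) \<in> test_functions"
        using Cons by (auto intro!: test_functions_add test_functions_cmult)
      have eq: "c (\<lambda>x. \<psi> x + t * \<eta> x) = (\<lambda>v. c \<psi> v + smul t (c \<eta> v))"
        using c(1) Cons.prems(2) Cons.hyps(1) test_functions_cmult[OF Cons.hyps(1), of t]
        by (simp add: linear_operator_family_def)
      have "\<tau> (X \<circ> (c (\<lambda>x. \<psi> x + t * \<eta> x) ^^ Suc k) \<circ> (word c l' \<circ> Y)) = 0"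
        by (rule Cons.IH[OF _ t]) (use Cons.prems(1) in simp)
      then show ?thesis
        unfolding eq q(1) .
    qed
    \<comment> \<open>The field is infinite, so a polynomial vanishing at every scalar is zero; in
      characteristic 0 the factor \<open>of_nat (Suc k)\<close> can then be cancelled.\<close>
    then have "q = 0"
      using poly_all_0_iff_0 by blast
    then have "\<tau> (X \<circ> (c \<psi> ^^ k) \<circ> c \<eta> \<circ> (word c l' \<circ> Y)) = 0"
      using q(2) by (simp del: of_nat_Suc)
    then show ?case
      by (simp only: comp_assoc word_Cons)
  qed
  \<comment> \<open>With k = 0 the power is the identity, so any test function may stand for
    \<psi>.\<close>
  from this[of l 0 "\<lambda>_. 0"] show ?thesis
    using l by (simp add: comp_assoc test_functions_zero)
qed

text \<open>Polarizes the creation, neutral and annihilation slots in turn; a slot not yet treated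
  is still a power.\<close>

lemma vacuum_monomial:
  assumes "T \<in> nontrivial_monomials"
  shows "\<tau> T = 0"
proof -
  obtain a b c where abc: "T = monomial a b c" "a \<in> lists test_functions"
      "b \<in> lists test_functions" "c \<in> lists test_functions" "(a, b, c) \<noteq> ([], [], [])"
    using assms by (auto simp: nontrivial_monomials_def)
  then have len: "length a + length b + length c \<ge> 1"
    by (cases a; cases b; cases c) auto
  have 1: "\<tau> (word ap a \<circ> (rho \<psi> ^^ length b) \<circ> (am \<xi> ^^ length c)) = 0"
    if "\<psi> \<in> test_functions" "\<xi> \<in> test_functions" for \<psi> \<xi>
  proof -
    have "\<tau> (id \<circ> word ap a \<circ> ((rho \<psi> ^^ length b) \<circ> (am \<xi> ^^ length c))) = 0"
      using that abc(2) vacuum_powers[OF _ that len]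
      by (intro vacuum_polarization lin_ap ap_comm comp_in funpow_in) (auto simp: comp_assoc)
    then show ?thesis by (simp add: comp_assoc)
  qed
  have 2: "\<tau> (word ap a \<circ> word rho b \<circ> (am \<xi> ^^ length c)) = 0"
    if "\<xi> \<in> test_functions" for \<xi>
    using that abc(2,3) 1
    by (intro vacuum_polarization lin_rho rho_comm comp_in funpow_in word_in) auto
  have "\<tau> (word ap a \<circ> word rho b \<circ> word am c \<circ> id) = 0"
    using abc(2-4) 2
    by (intro vacuum_polarization lin_am am_comm comp_in funpow_in word_in) auto
  then show ?thesis
    by (simp add: abc(1) monomial_def)
qed

lemma vacuum_normal0: "T \<in> normal0 \<Longrightarrow> \<tau> T = 0"
  by (induction rule: operator_span.induct)
    (simp_all add: vacuum_monomial vacuum_add vacuum_smult normal_in normal0_normal)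

lemma vacuum_ap_left: "S \<in> \<A> \<Longrightarrow> \<phi> \<in> test_functions \<Longrightarrow> \<tau> (ap \<phi> \<circ> S) = 0"
  and vacuum_rho_left: "S \<in> \<A> \<Longrightarrow> \<phi> \<in> test_functions \<Longrightarrow> \<tau> (rho \<phi> \<circ> S) = 0"
  and vacuum_am_right: "S \<in> \<A> \<Longrightarrow> \<phi> \<in> test_functions \<Longrightarrow> \<tau> (S \<circ> am \<phi>) = 0"
  by (simp_all add: vacuum_normal0 ap_normal rho_normal normal_am algebra_normal)

section \<open>The shifted annihilation operator and the moment recursion\<close>

definition shifted_am :: "('x \<Rightarrow> 'f) \<Rightarrow> 'v \<Rightarrow> 'v" where
  "shifted_am \<phi> = (\<lambda>v. am \<phi> v + smul (pairing \<sigma> \<phi>) v)"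

lemma shifted_am_in: "\<phi> \<in> test_functions \<Longrightarrow> shifted_am \<phi> \<in> \<A>"
  using smult_in[OF id_in] by (auto simp: shifted_am_def intro!: add_in)

text \<open>The commutator of a^-(\<phi>) with R(\<xi>) has two parts: a^-(\<phi> \<xi>) from
  \<rho>(\<xi>) and the scalar <\<sigma>, \<phi> \<xi>> from a^+(\<xi>). Together they are the
  shifted operator at \<phi> \<xi>, so the shift closes the relation.\<close>

lemma shifted_am_field_operator:
  assumes "\<phi> \<in> test_functions" "\<xi> \<in> test_functions"
  shows "shifted_am \<phi> (R \<xi> v) = R \<xi> (shifted_am \<phi> v) + shifted_am (\<lambda>x. \<phi> x * \<xi> x) v"
proof -
  have "am \<phi> (am \<xi> v) = am \<xi> (am \<phi> v)"
    using am_comm[OF assms] by (simp add: fun_eq_iff)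
  moreover have "am \<phi> (rho \<xi> v) = rho \<xi> (am \<phi> v) + am (\<lambda>x. \<phi> x * \<xi> x) v"
    using am_rho_swap[OF assms(2,1)] by (simp add: mult.commute)
  ultimately show ?thesis
    using algebra_add[OF am_in] algebra_add[OF ap_in] algebra_add[OF rho_in]
      algebra_scale[OF am_in] algebra_scale[OF ap_in] algebra_scale[OF rho_in] assms
    by (simp add: shifted_am_def field_operator_def am_ap_swap scale_right_distrib mult.commute)
qed

text \<open>At each R(\<xi>) the operator either passes, and R(\<xi>) joins \<open>S\<close>, or
  swallows \<xi>, exactly as in \<open>absorb\<close>. At the right end a^- is killed and the scalar
  \<open>pairing \<sigma> \<phi>\<close> remains.\<close>

lemma vacuum_shifted_am:
  assumes "S \<in> \<A>" "\<phi> \<in> test_functions" "L \<in> lists test_functions"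
  shows "\<tau> (S \<circ> shifted_am \<phi> \<circ> word R L) = absorb (pairing \<sigma>) \<phi> L (\<lambda>M. \<tau> (S \<circ> word R M))"
  using assms(3,1,2)
proof (induction L arbitrary: S \<phi>)
  case Nil
  have "S \<circ> shifted_am \<phi> = (\<lambda>v. (S \<circ> am \<phi>) v + smul (pairing \<sigma> \<phi>) (S v))"
    using Nil algebra_add algebra_scale by (simp add: shifted_am_def fun_eq_iff)
  moreover have "S \<circ> am \<phi> \<in> \<A>"
    using Nil by auto
  ultimately have "\<tau> (S \<circ> shifted_am \<phi>) = pairing \<sigma> \<phi> * \<tau> S"
    using Nil by (simp only: vacuum_add vacuum_smult vacuum_am_right smult_in add_0)
  then show ?case
    by (simp only: word_Nil absorb.simps comp_id)
next
  case (Cons \<xi> L)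
  let ?\<phi>\<xi> = "\<lambda>x. \<phi> x * \<xi> x"
  have m: "?\<phi>\<xi> \<in> test_functions"
    using Cons by (auto intro!: test_functions_mult)
  have R: "R \<xi> \<in> \<A>" "word R L \<in> \<A>"
    using Cons.hyps by (auto intro!: field_operator_in word_in)
  have "S \<circ> shifted_am \<phi> \<circ> word R (\<xi> # L) =
      (\<lambda>v. (S \<circ> R \<xi> \<circ> shifted_am \<phi> \<circ> word R L) v + (S \<circ> shifted_am ?\<phi>\<xi> \<circ> word R L) v)"
    using Cons algebra_add by (simp add: shifted_am_field_operator fun_eq_iff)
  moreover have "S \<circ> R \<xi> \<circ> shifted_am \<phi> \<circ> word R L \<in> \<A>" "S \<circ> shifted_am ?\<phi>\<xi> \<circ> word R L \<in> \<A>"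
    using Cons.prems R m by (auto intro!: comp_in shifted_am_in)
  moreover have "S \<circ> R \<xi> \<in> \<A>"
    using Cons.prems R by auto
  ultimately have "\<tau> (S \<circ> shifted_am \<phi> \<circ> word R (\<xi> # L)) =
      \<tau> (S \<circ> R \<xi> \<circ> shifted_am \<phi> \<circ> word R L) + \<tau> (S \<circ> shifted_am ?\<phi>\<xi> \<circ> word R L)"
    by (simp only: vacuum_add)
  also have "\<dots> = absorb (pairing \<sigma>) \<phi> L (\<lambda>M. \<tau> (S \<circ> R \<xi> \<circ> word R M)) +
      absorb (pairing \<sigma>) ?\<phi>\<xi> L (\<lambda>M. \<tau> (S \<circ> word R M))"
    using Cons.IH[OF \<open>S \<circ> R \<xi> \<in> \<A>\<close> Cons.prems(2)] Cons.IH[OF Cons.prems(1) m] by (simp only:)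
  finally show ?case
    by (simp only: absorb.simps word_Cons comp_assoc)
qed

lemma vacuum_moment_recursion:
  assumes "\<phi> \<in> test_functions" "L \<in> lists test_functions"
  shows "\<tau> (word R (\<phi> # L)) = absorb (pairing \<sigma>) \<phi> L (\<lambda>M. \<tau> (word R M))"
proof -
  have W: "word R L \<in> \<A>"
    using assms(2) by (auto intro!: field_operator_in word_in)
  have "word R (\<phi> # L) = (\<lambda>v. (ap \<phi> \<circ> word R L) v +
      ((rho \<phi> \<circ> word R L) v + (shifted_am \<phi> \<circ> word R L) v))"
    by (simp add: fun_eq_iff field_operator_def shifted_am_def)
  moreover have "ap \<phi> \<circ> word R L \<in> \<A>" "rho \<phi> \<circ> word R L \<in> \<A>" "shifted_am \<phi> \<circ> word R L \<in> \<A>"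
    using W assms(1) shifted_am_in by auto
  ultimately have "\<tau> (word R (\<phi> # L)) = \<tau> (shifted_am \<phi> \<circ> word R L)"
    using W assms(1) by (simp only: vacuum_add add_in vacuum_ap_left vacuum_rho_left add_0)
  also have "\<dots> = absorb (pairing \<sigma>) \<phi> L (\<lambda>M. \<tau> (word R M))"
    using vacuum_shifted_am[OF id_in assms] by simp
  finally show ?thesis .
qed

end

end

section \<open>Radon measures and their Jordan decomposition\<close>

lemma relcompact_borel_sets: "A \<in> relcompact_borel \<Longrightarrow> A \<in> sets borel"
  by (simp add: relcompact_borel_def)

lemma relcompact_borel_subset:
  assumes "A \<in> relcompact_borel" "B \<in> sets borel" "B \<subseteq> A"
  shows "B \<in> relcompact_borel"
proof -
  have "compact (closure A \<inter> closure B)"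
    using assms(1) by (intro compact_Int_closed) (auto simp: relcompact_borel_def)
  moreover have "closure A \<inter> closure B = closure B"
    using closure_mono[OF assms(3)] by blast
  ultimately show ?thesis
    using assms(2) by (simp add: relcompact_borel_def)
qed

lemma relcompact_borel_Un:
  "A \<in> relcompact_borel \<Longrightarrow> B \<in> relcompact_borel \<Longrightarrow> A \<union> B \<in> relcompact_borel"
  by (auto simp: relcompact_borel_def intro: compact_Un)

lemma relcompact_borel_empty [simp]: "{} \<in> relcompact_borel"
  by (simp add: relcompact_borel_def)

lemma relcompact_borel_Diff:
  "A \<in> relcompact_borel \<Longrightarrow> B \<in> sets borel \<Longrightarrow> A - B \<in> relcompact_borel"
  by (rule relcompact_borel_subset) (auto dest: relcompact_borel_sets)

lemma relcompact_borel_Int: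
  "A \<in> relcompact_borel \<Longrightarrow> B \<in> sets borel \<Longrightarrow> A \<inter> B \<in> relcompact_borel"
  by (rule relcompact_borel_subset) (auto dest: relcompact_borel_sets)

lemma compact_relcompact_borel:
  fixes K :: "'x::polish_space set"
  shows "compact K \<Longrightarrow> K \<in> relcompact_borel"
  by (simp add: relcompact_borel_def compact_imp_closed closure_closed borel_closed)

lemma radon_sums:
  assumes "\<sigma> \<in> radon_measures" "range A \<subseteq> relcompact_borel" "disjoint_family A"
    "(\<Union>i::nat. A i) \<in> relcompact_borel"
  shows "(\<lambda>i. \<sigma> (A i)) sums \<sigma> (\<Union>i. A i)"
  using assms by (simp add: radon_measures_def)

lemma radon_empty:
  assumes "\<sigma> \<in> radon_measures"
  shows "\<sigma> {} = 0"
proof -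
  have "(\<lambda>i::nat. \<sigma> {}) sums \<sigma> {}"
    using radon_sums[OF assms, of "\<lambda>_. {}"] by (simp add: disjoint_family_on_def)
  then have "(\<lambda>i::nat. \<sigma> {}) \<longlonglongrightarrow> 0"
    by (intro summable_LIMSEQ_zero sums_summable)
  then show ?thesis
    by (simp add: LIMSEQ_const_iff)
qed

lemma radon_Un:
  assumes "\<sigma> \<in> radon_measures" "A \<in> relcompact_borel" "B \<in> relcompact_borel" "A \<inter> B = {}"
  shows "\<sigma> (A \<union> B) = \<sigma> A + \<sigma> B"
proof -
  have "(\<lambda>i. \<sigma> (binaryset A B i)) sums \<sigma> (\<Union>i. binaryset A B i)"
    using assms
    by (intro radon_sums) (auto simp: range_binaryset_eq UN_binaryset_eq relcompact_borel_Un
        disjoint_family_on_def binaryset_def)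
  moreover have "(\<lambda>i. \<sigma> (binaryset A B i)) sums (\<sigma> A + \<sigma> B)"
    by (rule binaryset_sums) (rule radon_empty[OF assms(1)])
  ultimately show ?thesis
    using sums_unique2 by (fastforce simp: UN_binaryset_eq)
qed

lemma radon_Diff:
  assumes "\<sigma> \<in> radon_measures" "A \<in> relcompact_borel" "B \<in> sets borel" "B \<subseteq> A"
  shows "\<sigma> A = \<sigma> B + \<sigma> (A - B)"
proof -
  have "B \<union> (A - B) = A"
    using assms by auto
  then show ?thesis
    using radon_Un[of \<sigma> B "A - B"] assms
    by (simp add: relcompact_borel_Diff relcompact_borel_subset)
qed

text \<open>
  If the values of \<open>\<nu>\<close> on the subsets of \<open>C\<close> were unbounded, one could split off a piece of measure
  at least \<open>1\<close> in absolute value and leave a remainder with the same property; iterating would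
  contradict countable additivity.
\<close>

lemma radon_bounded:
  fixes \<nu> :: "'x::polish_space set \<Rightarrow> real"
  assumes \<nu>: "\<nu> \<in> radon_measures" and A: "A \<in> relcompact_borel"
  shows "\<exists>K. \<forall>B\<in>sets borel. B \<subseteq> A \<longrightarrow> \<bar>\<nu> B\<bar> \<le> K"
proof (rule ccontr)
  assume unbounded: "\<not> ?thesis"
  define unb where "unb C \<longleftrightarrow> C \<in> sets borel \<and> C \<subseteq> A \<and> (\<forall>K. \<exists>B\<in>sets borel. B \<subseteq> C \<and> K < \<bar>\<nu> B\<bar>)" for C
  have rb: "B \<in> relcompact_borel" if "B \<in> sets borel" "B \<subseteq> A" for B
    using relcompact_borel_subset[OF A] that .
  have unbA: "unb A"
    using unbounded relcompact_borel_sets[OF A] unfolding unb_def by (auto simp: not_le)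
  have split: "\<exists>D. unb D \<and> D \<subseteq> C \<and> 1 \<le> \<bar>\<nu> (C - D)\<bar>" if C: "unb C" for C
  proof -
    have C': "C \<in> sets borel" "C \<subseteq> A"
      using C by (auto simp: unb_def)
    \<comment> \<open>The margin \<bar>\<nu> C\<bar> + 1 forces both B and C - B to have measure at
      least 1 in absolute value, so whichever of them is unbounded can be kept.\<close>
    obtain B where B: "B \<in> sets borel" "B \<subseteq> C" "\<bar>\<nu> C\<bar> + 1 < \<bar>\<nu> B\<bar>"
      using C unfolding unb_def by blast
    have eq: "\<nu> C = \<nu> B + \<nu> (C - B)"
      using radon_Diff[OF \<nu> rb[OF C'] B(1,2)] .
    have "unb B \<or> unb (C - B)"
    proof (rule ccontr)
      assume "\<not> ?thesis"
      then have nunb: "\<not> unb B" "\<not> unb (C - B)"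
        by auto
      have "B \<subseteq> A" "C - B \<in> sets borel" "C - B \<subseteq> A"
        using B C' by auto
      then have "\<not> (\<forall>K. \<exists>E\<in>sets borel. E \<subseteq> B \<and> K < \<bar>\<nu> E\<bar>)"
          "\<not> (\<forall>K. \<exists>E\<in>sets borel. E \<subseteq> C - B \<and> K < \<bar>\<nu> E\<bar>)"
        using nunb B(1) by (simp_all add: unb_def)
      then obtain K1 K2 where
        K1: "\<And>E. E \<in> sets borel \<Longrightarrow> E \<subseteq> B \<Longrightarrow> \<bar>\<nu> E\<bar> \<le> K1" and
        K2: "\<And>E. E \<in> sets borel \<Longrightarrow> E \<subseteq> C - B \<Longrightarrow> \<bar>\<nu> E\<bar> \<le> K2"
        by (meson not_le)
      obtain E where E: "E \<in> sets borel" "E \<subseteq> C" "K1 + K2 < \<bar>\<nu> E\<bar>"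
        using C unfolding unb_def by blast
      have "E \<in> relcompact_borel"
        using rb E C' by blast
      then have "\<nu> E = \<nu> (E \<inter> B) + \<nu> (E - E \<inter> B)"
        using \<nu> E B by (intro radon_Diff) auto
      moreover have "\<bar>\<nu> (E \<inter> B)\<bar> \<le> K1" "\<bar>\<nu> (E - E \<inter> B)\<bar> \<le> K2"
        using E B by (auto intro!: K1 K2)
      ultimately show False
        using E(3) by linarith
    qed
    then show ?thesis
    proof
      assume "unb B"
      then show ?thesis
        using B eq by (intro exI[of _ B]) auto
    next
      assume "unb (C - B)"
      moreover have "C - (C - B) = B"
        using B by blast
      ultimately show ?thesis
        using B by (intro exI[of _ "C - B"]) auto
    qed
  qed
  obtain C where C: "\<And>n. unb (C n)" "\<And>n. C (Suc n) \<subseteq> C n \<and> 1 \<le> \<bar>\<nu> (C n - C (Suc n))\<bar>"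
    using dependent_nat_choice[of "\<lambda>_. unb" "\<lambda>_ C D. D \<subseteq> C \<and> 1 \<le> \<bar>\<nu> (C - D)\<bar>"] unbA split
    by metis
  have mono: "C n \<subseteq> C m" if "m \<le> n" for m n
    using lift_Suc_antimono_le[of C, OF _ that] C(2) by blast
  have meas: "C n \<in> sets borel" "C n \<subseteq> A" for n
    using C(1)[of n] by (auto simp: unb_def)
  let ?E = "\<lambda>n. C n - C (Suc n)"
  have "(\<lambda>n. \<nu> (?E n)) sums \<nu> (\<Union>n. ?E n)"
  proof (rule radon_sums[OF \<nu>])
    show "range ?E \<subseteq> relcompact_borel"
      using meas by (auto intro!: rb)
    show "(\<Union>n. ?E n) \<in> relcompact_borel"
      using meas by (intro rb sets.countable_UN) auto
    show "disjoint_family ?E"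
      unfolding disjoint_family_on_def
    proof (intro ballI impI)
      fix m n :: nat
      assume "m \<noteq> n"
      then show "?E m \<inter> ?E n = {}"
        using mono[of "Suc m" n] mono[of "Suc n" m] by (cases "m < n") auto
    qed
  qed
  then have "(\<lambda>n. \<nu> (?E n)) \<longlonglongrightarrow> 0"
    using sums_summable summable_LIMSEQ_zero by blast
  then obtain n where "\<bar>\<nu> (?E n)\<bar> < 1"
    by (force simp: LIMSEQ_iff dest: spec[of _ 1])
  then show False
    using C(2)[of n] by simp
qed

section \<open>The upper variation is a measure\<close>

definition upper_sup :: "('x::polish_space set \<Rightarrow> real) \<Rightarrow> 'x set \<Rightarrow> ennreal" where
  "upper_sup \<nu> A = (SUP B\<in>{B \<in> relcompact_borel. B \<subseteq> A}. ennreal (\<nu> B))"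

lemma upper_sup_upper: "B \<in> relcompact_borel \<Longrightarrow> B \<subseteq> A \<Longrightarrow> ennreal (\<nu> B) \<le> upper_sup \<nu> A"
  unfolding upper_sup_def by (rule SUP_upper) auto

lemma upper_sup_least:
  "(\<And>B. B \<in> relcompact_borel \<Longrightarrow> B \<subseteq> A \<Longrightarrow> ennreal (\<nu> B) \<le> K) \<Longrightarrow> upper_sup \<nu> A \<le> K"
  unfolding upper_sup_def by (rule SUP_least) auto

lemma upper_sup_mono: "A \<subseteq> A' \<Longrightarrow> upper_sup \<nu> A \<le> upper_sup \<nu> A'"
  by (rule upper_sup_least) (blast intro: upper_sup_upper)

lemma upper_sup_superadditive:
  assumes \<nu>: "\<nu> \<in> radon_measures" and AB: "A \<inter> A' = {}"
  shows "upper_sup \<nu> A + upper_sup \<nu> A' \<le> upper_sup \<nu> (A \<union> A')"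
proof -
  have le: "ennreal (\<nu> B) + ennreal (\<nu> B') \<le> upper_sup \<nu> (A \<union> A')"
    if B: "B \<in> relcompact_borel" "B \<subseteq> A" and B': "B' \<in> relcompact_borel" "B' \<subseteq> A'" for B B'
  \<comment> \<open>A nonpositive value is truncated to 0 and could only lower the union, so in that
    case the other set alone is the competitor.\<close>
  proof (cases "\<nu> B \<le> 0 \<or> \<nu> B' \<le> 0")
    case True
    then have "ennreal (\<nu> B) + ennreal (\<nu> B') \<in> {ennreal (\<nu> B), ennreal (\<nu> B')}"
      by (auto simp: ennreal_neg)
    moreover have "ennreal (\<nu> B) \<le> upper_sup \<nu> (A \<union> A')" "ennreal (\<nu> B') \<le> upper_sup \<nu> (A \<union> A')"
      using B B' by (auto intro!: upper_sup_upper)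
    ultimately show ?thesis
      by auto
  next
    case False
    have "\<nu> (B \<union> B') = \<nu> B + \<nu> B'"
      using B B' AB by (intro radon_Un[OF \<nu>]) auto
    moreover have "ennreal (\<nu> (B \<union> B')) \<le> upper_sup \<nu> (A \<union> A')"
      using B B' by (intro upper_sup_upper relcompact_borel_Un) auto
    ultimately show ?thesis
      using False by (simp add: ennreal_plus)
  qed
  have ne: "{B \<in> relcompact_borel. B \<subseteq> A} \<noteq> {}" "{B \<in> relcompact_borel. B \<subseteq> A'} \<noteq> {}"
    using relcompact_borel_empty by blast+
  have "ennreal (\<nu> B) + upper_sup \<nu> A' \<le> upper_sup \<nu> (A \<union> A')"
    if "B \<in> relcompact_borel" "B \<subseteq> A" for B
  proof -
    have "ennreal (\<nu> B) + upper_sup \<nu> A' =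
        (SUP B'\<in>{B \<in> relcompact_borel. B \<subseteq> A'}. ennreal (\<nu> B) + ennreal (\<nu> B'))"
      unfolding upper_sup_def by (rule ennreal_SUP_add_right[OF ne(2)])
    also have "\<dots> \<le> upper_sup \<nu> (A \<union> A')"
      by (rule SUP_least) (use that le in auto)
    finally show ?thesis .
  qed
  then have "(SUP B\<in>{B \<in> relcompact_borel. B \<subseteq> A}. ennreal (\<nu> B) + upper_sup \<nu> A') \<le>
      upper_sup \<nu> (A \<union> A')"
    by (intro SUP_least) auto
  moreover have "upper_sup \<nu> A + upper_sup \<nu> A' =
      (SUP B\<in>{B \<in> relcompact_borel. B \<subseteq> A}. ennreal (\<nu> B) + upper_sup \<nu> A')"
    unfolding upper_sup_def[of \<nu> A] by (rule ennreal_SUP_add_left[OF ne(1), symmetric])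
  ultimately show ?thesis
    by simp
qed

text \<open>Subadditivity of the positive part, since \<open>ennreal\<close> truncates at 0.\<close>

lemma ennreal_sum_le: "ennreal (\<Sum>i\<in>I. f i) \<le> (\<Sum>i\<in>I. ennreal (f i))"
proof (induction I rule: infinite_finite_induct)
  case (insert i I)
  have "ennreal (f i + sum f I) \<le> ennreal (f i) + ennreal (sum f I)"
    by (cases "0 \<le> f i"; cases "0 \<le> sum f I")
      (auto simp: ennreal_plus ennreal_neg not_le intro!: ennreal_leI)
  also have "\<dots> \<le> ennreal (f i) + (\<Sum>i\<in>I. ennreal (f i))"
    using insert.IH by (intro add_left_mono)
  finally show ?case
    using insert.hyps by simp
qed auto

text \<open>Superadditivity and monotonicity bound the partial sums. Conversely, a competitor B for
  the union is cut along the sets A i, and countable additivity of \<nu> on these relatively compact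
  pieces recovers \<nu> B.\<close>

lemma upper_sup_countably_additive:
  assumes \<nu>: "\<nu> \<in> radon_measures"
  shows "countably_additive (sets borel) (upper_sup \<nu>)"
proof (rule countably_additiveI)
  fix A :: "nat \<Rightarrow> 'a set"
  assume A: "range A \<subseteq> sets borel" "disjoint_family A"
  show "(\<Sum>i. upper_sup \<nu> (A i)) = upper_sup \<nu> (\<Union>i. A i)"
  proof (rule antisym)
    have "(\<Sum>i<n. upper_sup \<nu> (A i)) \<le> upper_sup \<nu> (\<Union>i<n. A i)" for n
    proof (induction n)
      case (Suc n)
      have "A i \<inter> A n = {}" if "i < n" for i
        using A(2) that by (simp add: disjoint_family_on_def)
      then have "(\<Union>i<n. A i) \<inter> A n = {}"
        by auto
      then have "upper_sup \<nu> (\<Union>i<n. A i) + upper_sup \<nu> (A n) \<le> upper_sup \<nu> ((\<Union>i<n. A i) \<union> A n)"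
        by (rule upper_sup_superadditive[OF \<nu>])
      also have "(\<Union>i<n. A i) \<union> A n = (\<Union>i<Suc n. A i)"
        by (auto simp: lessThan_Suc)
      finally show ?case
        using Suc by (simp add: order_trans[OF add_right_mono])
    qed simp
    also have "upper_sup \<nu> (\<Union>i<n. A i) \<le> upper_sup \<nu> (\<Union>i. A i)" for n
      by (rule upper_sup_mono) auto
    finally show "(\<Sum>i. upper_sup \<nu> (A i)) \<le> upper_sup \<nu> (\<Union>i. A i)"
      by (intro suminf_le_const) auto
  next
    show "upper_sup \<nu> (\<Union>i. A i) \<le> (\<Sum>i. upper_sup \<nu> (A i))"
    proof (rule upper_sup_least)
      fix B assume B: "B \<in> relcompact_borel" "B \<subseteq> (\<Union>i. A i)"
      have BA: "(\<Union>i. B \<inter> A i) = B"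
        using B by auto
      have rb: "B \<inter> A i \<in> relcompact_borel" for i
        using A by (intro relcompact_borel_Int B(1)) auto
      have "(\<lambda>i. \<nu> (B \<inter> A i)) sums \<nu> (\<Union>i. B \<inter> A i)"
        using A rb B by (intro radon_sums[OF \<nu>]) (auto simp: disjoint_family_on_def Int_absorb2)
      then have "(\<lambda>n. ennreal (\<Sum>i<n. \<nu> (B \<inter> A i))) \<longlonglongrightarrow> ennreal (\<nu> B)"
        unfolding BA sums_def by (rule tendsto_ennrealI)
      moreover have "ennreal (\<Sum>i<n. \<nu> (B \<inter> A i)) \<le> (\<Sum>i. upper_sup \<nu> (A i))" for n
      proof -
        have "ennreal (\<Sum>i<n. \<nu> (B \<inter> A i)) \<le> (\<Sum>i<n. ennreal (\<nu> (B \<inter> A i)))"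
          by (rule ennreal_sum_le)
        also have "\<dots> \<le> (\<Sum>i<n. upper_sup \<nu> (A i))"
          by (intro sum_mono upper_sup_upper rb) auto
        also have "\<dots> \<le> (\<Sum>i. upper_sup \<nu> (A i))"
          by (intro sum_le_suminf) auto
        finally show ?thesis .
      qed
      ultimately show "ennreal (\<nu> B) \<le> (\<Sum>i. upper_sup \<nu> (A i))"
        by (intro LIMSEQ_le_const2) auto
    qed
  qed
qed

lemma sets_upper_variation [simp, measurable_cong]: "sets (upper_variation \<nu>) = sets borel"
  unfolding upper_variation_def using sets.sets_measure_of_eq[of borel] by simp

lemma space_upper_variation [simp]: "space (upper_variation \<nu>) = UNIV"
  unfolding upper_variation_def by (simp add: space_measure_of_conv)

lemma emeasure_upper_variation:
  assumes \<nu>: "\<nu> \<in> radon_measures" and A: "A \<in> sets borel"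
  shows "emeasure (upper_variation \<nu>) A = upper_sup \<nu> A"
proof -
  have "upper_sup \<nu> {} \<le> 0"
    by (rule upper_sup_least) (simp add: radon_empty[OF \<nu>])
  then have "positive (sets borel) (upper_sup \<nu>)"
    by (simp add: positive_def)
  moreover have "sigma_algebra UNIV (sets (borel :: 'a measure))"
    using sets.sigma_algebra_axioms[of borel] by simp
  ultimately show ?thesis
    unfolding upper_variation_def upper_sup_def[symmetric, abs_def]
    using upper_sup_countably_additive[OF \<nu>] A by (intro emeasure_measure_of_sigma)
qed

lemma emeasure_upper_variation_finite:
  assumes \<nu>: "\<nu> \<in> radon_measures" and A: "A \<in> relcompact_borel"
  shows "emeasure (upper_variation \<nu>) A < \<infinity>"
proof -
  obtain K where "\<And>B. B \<in> sets borel \<Longrightarrow> B \<subseteq> A \<Longrightarrow> \<bar>\<nu> B\<bar> \<le> K"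
    using radon_bounded[OF assms] by blast
  then have "upper_sup \<nu> A \<le> ennreal K"
    by (intro upper_sup_least ennreal_leI) (auto dest: relcompact_borel_sets abs_le_D1)
  then show ?thesis
    using emeasure_upper_variation[OF \<nu> relcompact_borel_sets[OF A]] by (auto simp: le_less_trans)
qed

lemma radon_measures_cmult:
  fixes \<nu> :: "'x::polish_space set \<Rightarrow> real"
  shows "\<nu> \<in> radon_measures \<Longrightarrow> (\<lambda>A. c * \<nu> A) \<in> radon_measures"
  by (auto simp: radon_measures_def intro: sums_mult)

lemma radon_measures_uminus:
  fixes \<nu> :: "'x::polish_space set \<Rightarrow> real"
  shows "\<nu> \<in> radon_measures \<Longrightarrow> (\<lambda>A. - \<nu> A) \<in> radon_measures"
  by (auto simp: radon_measures_def intro: sums_minus)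

lemma radon_measures_inner:
  "\<sigma> \<in> radon_measures \<Longrightarrow> (\<lambda>A. \<sigma> A \<bullet> b) \<in> radon_measures"
  by (auto simp: radon_measures_def intro: bounded_linear.sums[OF bounded_linear_inner_left])

text \<open>For B inside A, \<nu> B = \<nu> A - \<nu> (A - B), and the last term is controlled by
  the upper variation of -\<nu>. Applied to \<nu> and to -\<nu> this gives the Jordan
  decomposition.\<close>

lemma upper_variation_le:
  assumes \<nu>: "\<nu> \<in> radon_measures" and A: "A \<in> relcompact_borel"
  shows "measure (upper_variation \<nu>) A \<le> \<nu> A + measure (upper_variation (\<lambda>B. - \<nu> B)) A"
proof -
  note \<nu>' = radon_measures_uminus[OF \<nu>]
  let ?u = "measure (upper_variation (\<lambda>B. - \<nu> B)) A"
  have le: "- \<nu> B \<le> ?u" if "B \<in> sets borel" "B \<subseteq> A" for B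
  proof -
    have "ennreal (- \<nu> B) \<le> emeasure (upper_variation (\<lambda>B. - \<nu> B)) A"
      using upper_sup_upper[OF relcompact_borel_subset[OF A that] that(2), of "\<lambda>B. - \<nu> B"]
        emeasure_upper_variation[OF \<nu>' relcompact_borel_sets[OF A]] by simp
    also have "\<dots> = ennreal ?u"
      using emeasure_upper_variation_finite[OF \<nu>' A] by (intro emeasure_eq_ennreal_measure) auto
    finally show ?thesis
      by (simp add: ennreal_le_iff)
  qed
  have "emeasure (upper_variation \<nu>) A \<le> ennreal (\<nu> A + ?u)"
    unfolding emeasure_upper_variation[OF \<nu> relcompact_borel_sets[OF A]]
  proof (intro upper_sup_least ennreal_leI)
    fix B assume B: "B \<in> relcompact_borel" "B \<subseteq> A"
    then have "\<nu> A = \<nu> B + \<nu> (A - B)"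
      using radon_Diff[OF \<nu> A] relcompact_borel_sets by blast
    moreover have "- \<nu> (A - B) \<le> ?u"
      using A B relcompact_borel_sets by (intro le) blast+
    ultimately show "\<nu> B \<le> \<nu> A + ?u"
      by linarith
  qed
  \<comment> \<open>The case B = A of \<open>le\<close>; it rules out truncation of the bound by
    \<open>ennreal\<close>.\<close>
  moreover have "0 \<le> \<nu> A + ?u"
    using le[OF relcompact_borel_sets[OF A]] by simp
  ultimately show ?thesis
    unfolding measure_def by (metis enn2real_leI)
qed

lemma upper_variation_jordan:
  assumes \<nu>: "\<nu> \<in> radon_measures" and A: "A \<in> relcompact_borel"
  shows "measure (upper_variation \<nu>) A - measure (upper_variation (\<lambda>B. - \<nu> B)) A = \<nu> A"
  using upper_variation_le[OF \<nu> A] upper_variation_le[OF radon_measures_uminus[OF \<nu>] A] by simp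

lemma jordan_component_radon:
  "\<sigma> \<in> radon_measures \<Longrightarrow> (\<lambda>A. snd j * (\<sigma> A \<bullet> fst j)) \<in> radon_measures"
  by (intro radon_measures_cmult radon_measures_inner)

lemma sets_jordan_part [simp, measurable_cong]: "sets (jordan_part \<sigma> j) = sets borel"
  and space_jordan_part [simp]: "space (jordan_part \<sigma> j) = UNIV"
  by (simp_all add: jordan_part_def)

lemma emeasure_jordan_part_finite:
  "\<sigma> \<in> radon_measures \<Longrightarrow> A \<in> relcompact_borel \<Longrightarrow> emeasure (jordan_part \<sigma> j) A < \<infinity>"
  unfolding jordan_part_def by (intro emeasure_upper_variation_finite jordan_component_radon)

lemma finite_jordan_index [simp]: "finite jordan_index"
  by (simp add: jordan_index_def)

lemma jordan_decomposition:
  assumes \<sigma>: "\<sigma> \<in> radon_measures" and A: "A \<in> relcompact_borel"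
  shows "(\<Sum>j\<in>jordan_index. jordan_coeff j * of_real (measure (jordan_part \<sigma> j) A)) = \<sigma> A"
proof -
  have "(\<Sum>j\<in>jordan_index. jordan_coeff j * of_real (measure (jordan_part \<sigma> j) A)) =
      (\<Sum>b\<in>Basis. \<Sum>s\<in>{1, -1}. jordan_coeff (b, s) * of_real (measure (jordan_part \<sigma> (b, s)) A))"
    unfolding jordan_index_def by (subst sum.cartesian_product) (simp add: case_prod_beta)
  also have "\<dots> = (\<Sum>b\<in>Basis. (\<sigma> A \<bullet> b) *\<^sub>R b)"
  proof (rule sum.cong[OF refl])
    fix b :: 'b
    let ?\<nu> = "\<lambda>A. \<sigma> A \<bullet> b"
    have "measure (upper_variation ?\<nu>) A = ?\<nu> A + measure (upper_variation (\<lambda>B. - ?\<nu> B)) A"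
      using upper_variation_jordan[OF radon_measures_inner[OF \<sigma>] A, of b] by simp
    then show "(\<Sum>s\<in>{1, -1}. jordan_coeff (b, s) * of_real (measure (jordan_part \<sigma> (b, s)) A)) =
        (\<sigma> A \<bullet> b) *\<^sub>R b"
      by (simp add: jordan_coeff_def jordan_part_def scaleR_conv_of_real mult.commute[of b] distrib_right)
  qed
  also have "\<dots> = \<sigma> A"
    by (rule euclidean_representation)
  finally show ?thesis .
qed

section \<open>Pairings with test functions\<close>

lemma test_function_borel: "f \<in> test_functions \<Longrightarrow> f \<in> borel_measurable borel"
  by (simp add: test_functions_def)

lemma integrable_test_function:
  assumes "\<sigma> \<in> radon_measures" "f \<in> test_functions"
  shows "integrable (jordan_part \<sigma> j) f"
proof -
  obtain K B where K: "compact K" "\<And>x. x \<notin> K \<Longrightarrow> f x = 0" and B: "\<And>x. norm (f x) \<le> B"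
    using assms(2) by (auto simp: test_functions_def bounded_iff)
  show ?thesis
  proof (rule integrableI_bounded_set[where A = K and B = B])
    show "K \<in> sets (jordan_part \<sigma> j)"
      using relcompact_borel_sets[OF compact_relcompact_borel[OF K(1)]] by simp
    show "f \<in> borel_measurable (jordan_part \<sigma> j)"
      using test_function_borel[OF assms(2)] by (simp cong: measurable_cong_sets)
    show "emeasure (jordan_part \<sigma> j) K < \<infinity>"
      by (intro emeasure_jordan_part_finite compact_relcompact_borel assms K)
  qed (use K B in auto)
qed

text \<open>
  The approximants do not depend on the measure, so the pairing with a fixed test function is
  determined by, and linear in, the values of the measure on relatively compact sets.
\<close>

lemma pairing_approximation:
  fixes f :: "'x::polish_space \<Rightarrow> 'f::{real_normed_field,euclidean_space}"
  assumes f: "f \<in> test_functions"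
  obtains s :: "nat \<Rightarrow> 'x \<Rightarrow> 'f" where "\<And>n. finite (range (s n))"
    "\<And>x. (\<lambda>n. s n x) \<longlonglongrightarrow> f x"
    "\<And>\<omega>. \<omega> \<in> radon_measures \<Longrightarrow>
      (\<lambda>n. \<Sum>y\<in>range (s n) - {0}. y * \<omega> (s n -` {y})) \<longlonglongrightarrow> pairing \<omega> f"
proof -
  \<comment> \<open>The bound by 2 * norm (f x) serves twice: it keeps the approximants zero off the
    support of f, and it is the dominating function below.\<close>
  obtain s where s: "\<And>n. simple_function borel (s n)" "\<And>x. (\<lambda>n. s n x) \<longlonglongrightarrow> f x"
      "\<And>n x. norm (s n x) \<le> 2 * norm (f x)"
    using borel_measurable_implies_sequence_metric[OF test_function_borel[OF f], of 0] by auto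
  have fin: "finite (range (s n))" and borel: "s n -` {y} \<in> sets borel" for n y
  proof -
    show "finite (range (s n))"
      using s(1)[of n] by (simp add: simple_function_def)
    show "s n -` {y} \<in> sets borel"
      using measurable_sets[OF borel_measurable_simple_function[OF s(1)[of n]], of "{y}"] by simp
  qed
  obtain K where K: "compact K" "\<And>x. x \<notin> K \<Longrightarrow> f x = 0"
    using f by (auto simp: test_functions_def)
  \<comment> \<open>The level set of 0 is left out throughout: it may fail to be relatively compact,
    and there \<omega> has no meaningful value.\<close>
  have rb: "s n -` {y} \<in> relcompact_borel" if "y \<noteq> 0" for n y
  proof (rule relcompact_borel_subset[OF compact_relcompact_borel[OF K(1)] borel])
    show "s n -` {y} \<subseteq> K"
    proof
      fix x assume "x \<in> s n -` {y}"
      then show "x \<in> K"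
        using that K(2)[of x] s(3)[of n x] by (cases "x \<in> K") auto
    qed
  qed
  have s_sum: "s n x = (\<Sum>y\<in>range (s n) - {0}. indicator (s n -` {y}) x *\<^sub>R y)" for n x
    using fin[of n] by (subst sum.mono_neutral_cong_left[where T = "range (s n)"
        and h = "\<lambda>y. if y = s n x then y else 0"])
      (auto simp: indicator_def sum.delta')
  have lim: "(\<lambda>n. \<Sum>y\<in>range (s n) - {0}. y * \<omega> (s n -` {y})) \<longlonglongrightarrow> pairing \<omega> f"
    if \<omega>: "\<omega> \<in> radon_measures" for \<omega>
  proof -
    have int: "(LINT x|jordan_part \<omega> j. s n x) =
        (\<Sum>y\<in>range (s n) - {0}. of_real (measure (jordan_part \<omega> j) (s n -` {y})) * y)" for n j
    proof -
      have "has_bochner_integral (jordan_part \<omega> j)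
          (\<lambda>x. \<Sum>y\<in>range (s n) - {0}. indicator (s n -` {y}) x *\<^sub>R y)
          (\<Sum>y\<in>range (s n) - {0}. measure (jordan_part \<omega> j) (s n -` {y}) *\<^sub>R y)"
        using emeasure_jordan_part_finite[OF \<omega> rb] borel
        by (intro has_bochner_integral_sum has_bochner_integral_indicator) auto
      then show ?thesis
        unfolding s_sum[of n, symmetric] by (simp add: has_bochner_integral_integral_eq scaleR_conv_of_real)
    qed
    have "(\<Sum>y\<in>range (s n) - {0}. y * \<omega> (s n -` {y})) = pairing \<omega> (s n)" for n
    proof -
      have "pairing \<omega> (s n) = (\<Sum>y\<in>range (s n) - {0}. \<Sum>j\<in>jordan_index.
          y * (jordan_coeff j * of_real (measure (jordan_part \<omega> j) (s n -` {y}))))"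
        unfolding pairing_def int sum_distrib_left by (subst sum.swap) (simp add: mult_ac)
      also have "\<dots> = (\<Sum>y\<in>range (s n) - {0}. y * \<omega> (s n -` {y}))"
        by (intro sum.cong refl) (simp add: sum_distrib_left[symmetric] jordan_decomposition[OF \<omega> rb])
      finally show ?thesis ..
    qed
    moreover have "(\<lambda>n. pairing \<omega> (s n)) \<longlonglongrightarrow> pairing \<omega> f"
      unfolding pairing_def
    proof (intro tendsto_sum tendsto_mult tendsto_const)
      fix j :: "'f \<times> real"
      show "(\<lambda>n. LINT x|jordan_part \<omega> j. s n x) \<longlonglongrightarrow> (LINT x|jordan_part \<omega> j. f x)"
      proof (rule integral_dominated_convergence[where w = "\<lambda>x. 2 * norm (f x)"])
        show "f \<in> borel_measurable (jordan_part \<omega> j)" "s n \<in> borel_measurable (jordan_part \<omega> j)" for n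
          using test_function_borel[OF f] borel_measurable_simple_function[OF s(1)]
          by (simp_all cong: measurable_cong_sets)
        show "integrable (jordan_part \<omega> j) (\<lambda>x. 2 * norm (f x))"
          using integrable_test_function[OF \<omega> f] by auto
      qed (use s in auto)
    qed
    ultimately show ?thesis
      by simp
  qed
  from that[OF fin s(2) lim] show thesis .
qed

lemma pairing_indicator:
  fixes \<sigma> :: "'x::polish_space set \<Rightarrow> 'f::{real_normed_field,euclidean_space}"
  assumes \<sigma>: "\<sigma> \<in> radon_measures" and A: "A \<in> relcompact_borel"
  shows "pairing \<sigma> (indicator A) = \<sigma> A"
proof -
  have "(LINT x|jordan_part \<sigma> j. indicator A x) = (of_real (measure (jordan_part \<sigma> j) A) :: 'f)" for j
  proof -
    have "has_bochner_integral (jordan_part \<sigma> j) (\<lambda>x. indicator A x *\<^sub>R (1::'f))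
        (measure (jordan_part \<sigma> j) A *\<^sub>R 1)"
      using emeasure_jordan_part_finite[OF assms] relcompact_borel_sets[OF A]
      by (intro has_bochner_integral_indicator) auto
    moreover have "(\<lambda>x. indicator A x *\<^sub>R (1::'f)) = indicator A"
      by (auto simp: indicator_def)
    ultimately show ?thesis
      by (simp add: has_bochner_integral_integral_eq scaleR_conv_of_real)
  qed
  then show ?thesis
    unfolding pairing_def by (simp add: jordan_decomposition[OF assms])
qed

section \<open>Finitely supported measures\<close>

definition discrete_measure ::
  "nat \<Rightarrow> (nat \<Rightarrow> 'f) \<Rightarrow> (nat \<Rightarrow> 'x) \<Rightarrow> 'x set \<Rightarrow> 'f::real_normed_field"
  where "discrete_measure m c x = (\<lambda>A. \<Sum>i<m. c i * indicator A (x i))"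

lemma dirac_sum_eq: "dirac_sum m x = discrete_measure m (\<lambda>_. 1) x"
  by (simp add: dirac_sum_def discrete_measure_def)

lemma discrete_measure_radon: "discrete_measure m c x \<in> radon_measures"
  unfolding radon_measures_def discrete_measure_def
proof (intro CollectI allI impI sums_sum sums_mult)
  fix A :: "nat \<Rightarrow> 'a set" and i
  assume "disjoint_family A"
  then have "(\<lambda>k. indicator (A k) (x i) :: real) sums indicator (\<Union>k. A k) (x i)"
    by (intro indicator_sums) (auto simp: disjoint_family_on_def)
  then have "(\<lambda>k. of_real (indicator (A k) (x i)) :: 'b) sums of_real (indicator (\<Union>k. A k) (x i))"
    by (rule sums_of_real)
  moreover have "of_real (indicator B (x i)) = (indicator B (x i) :: 'b)" for B
    by (simp add: indicator_def)
  ultimately show "(\<lambda>k. indicator (A k) (x i) :: 'b) sums indicator (\<Union>k. A k) (x i)"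
    by simp
qed

text \<open>Points may coincide and coefficients are arbitrary, so the Jordan parts are awkward to
  write down. The approximants avoid them: for a simple function only the values of the measure on
  level sets enter.\<close>

lemma pairing_discrete_measure:
  fixes f :: "'x::polish_space \<Rightarrow> 'f::{real_normed_field,euclidean_space}"
  assumes f: "f \<in> test_functions"
  shows "pairing (discrete_measure m c x) f = (\<Sum>i<m. c i * f (x i))"
proof -
  obtain s :: "nat \<Rightarrow> 'x \<Rightarrow> 'f" where s: "\<And>n. finite (range (s n))"
      "\<And>x. (\<lambda>n. s n x) \<longlonglongrightarrow> f x"
      "\<And>\<omega>. \<omega> \<in> radon_measures \<Longrightarrow>
        (\<lambda>n. \<Sum>y\<in>range (s n) - {0}. y * \<omega> (s n -` {y})) \<longlonglongrightarrow> pairing \<omega> f"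
    using pairing_approximation[OF f] by blast
  have "(\<Sum>y\<in>range (s n) - {0}. y * discrete_measure m c x (s n -` {y})) = (\<Sum>i<m. c i * s n (x i))" for n
  proof -
    have "(\<Sum>y\<in>range (s n) - {0}. y * discrete_measure m c x (s n -` {y})) =
        (\<Sum>i<m. \<Sum>y\<in>range (s n) - {0}. c i * (y * indicator (s n -` {y}) (x i)))"
      unfolding discrete_measure_def sum_distrib_left by (subst sum.swap) (simp add: mult_ac)
    also have "\<dots> = (\<Sum>i<m. c i * s n (x i))"
    proof (intro sum.cong refl)
      fix i
      have "(\<Sum>y\<in>range (s n) - {0}. y * indicator (s n -` {y}) (x i)) = s n (x i)"
        using s(1)[of n] by (subst sum.mono_neutral_cong_left[where T = "range (s n)"
            and h = "\<lambda>y. if y = s n (x i) then y else 0"])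
          (auto simp: indicator_def sum.delta')
      then show "(\<Sum>y\<in>range (s n) - {0}. c i * (y * indicator (s n -` {y}) (x i))) = c i * s n (x i)"
        by (simp add: sum_distrib_left[symmetric])
    qed
    finally show ?thesis .
  qed
  then have "(\<lambda>n. \<Sum>i<m. c i * s n (x i)) \<longlonglongrightarrow> pairing (discrete_measure m c x) f"
    using s(3)[OF discrete_measure_radon[of m c x]] by simp
  moreover have "(\<lambda>n. \<Sum>i<m. c i * s n (x i)) \<longlonglongrightarrow> (\<Sum>i<m. c i * f (x i))"
    by (intro tendsto_sum tendsto_mult tendsto_const s(2))
  ultimately show ?thesis
    by (rule LIMSEQ_unique)
qed

lemma pairing_dirac_sum:
  fixes f :: "'x::polish_space \<Rightarrow> 'f::{real_normed_field,euclidean_space}"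
  shows "f \<in> test_functions \<Longrightarrow> pairing (dirac_sum m x) f = (\<Sum>i<m. f (x i))"
  by (simp add: dirac_sum_eq pairing_discrete_measure)

section \<open>Product measures\<close>

text \<open>Local compactness covers the space by open relatively compact sets, which have finite
  measure; Lindelof leaves countably many.\<close>

lemma sigma_finite_jordan_part:
  fixes \<sigma> :: "'x::polish_space set \<Rightarrow> 'f::{real_normed_field,euclidean_space}"
  assumes lc: "locally_compact_space (euclidean :: 'x topology)" and \<sigma>: "\<sigma> \<in> radon_measures"
  shows "sigma_finite_measure (jordan_part \<sigma> j)"
proof
  let ?F = "{U :: 'x set. open U \<and> compact (closure U)}"
  have "\<exists>U\<in>?F. x \<in> U" for x :: 'x
  proof -
    have "\<exists>U K. open U \<and> compact K \<and> x \<in> U \<and> U \<subseteq> K"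
      using lc unfolding locally_compact_space_def by simp
    then obtain U K where U: "open U" "compact K" "x \<in> U" "U \<subseteq> K"
      by blast
    then have "closure U \<subseteq> K"
      by (intro closure_minimal compact_imp_closed)
    then have "compact (closure U)"
      using U(2) by (metis closed_closure compact_Int_closed inf.absorb2)
    then show ?thesis
      using U by blast
  qed
  then have "\<Union>?F = UNIV"
    by blast
  moreover obtain F' where F': "F' \<subseteq> ?F" "countable F'" "\<Union>F' = \<Union>?F"
    using Lindelof[of ?F] by blast
  moreover have "emeasure (jordan_part \<sigma> j) U \<noteq> \<infinity>" if "U \<in> ?F" for U
    using that emeasure_jordan_part_finite[OF \<sigma>, of U j]
    by (auto simp: relcompact_borel_def)
  ultimately show "\<exists>A. countable A \<and> A \<subseteq> sets (jordan_part \<sigma> j) \<and>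
      \<Union>A = space (jordan_part \<sigma> j) \<and> (\<forall>a\<in>A. emeasure (jordan_part \<sigma> j) a \<noteq> \<infinity>)"
    by (intro exI[of _ F']) auto
qed

lemma product_sigma_finite_jordan_part:
  fixes \<sigma> :: "'x::polish_space set \<Rightarrow> 'f::{real_normed_field,euclidean_space}"
  assumes "locally_compact_space (euclidean :: 'x topology)" "\<sigma> \<in> radon_measures"
  shows "product_sigma_finite (\<lambda>i. jordan_part \<sigma> (c i))"
  by (intro product_sigma_finite.intro sigma_finite_jordan_part assms)

lemma space_PiM_jordan_part [simp]:
  "space (\<Pi>\<^sub>M i\<in>I. jordan_part \<sigma> (c i)) = I \<rightarrow>\<^sub>E UNIV"
  by (simp add: space_PiM)

lemma pairing_power_cong:
  assumes "\<And>x. x \<in> {..<k} \<rightarrow>\<^sub>E UNIV \<Longrightarrow> f x = g x"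
  shows "pairing_power k \<sigma> f = pairing_power k \<sigma> g"
  unfolding pairing_power_def
  by (intro sum.cong refl arg_cong2[where f = "(*)"] Bochner_Integration.integral_cong)
    (simp_all add: assms)

text \<open>A nonintegrable function has integral 0 by convention, so additivity of
  \<open>pairing_power\<close> requires integrability against each product in the expansion.\<close>

definition power_integrable ::
  "nat \<Rightarrow> ('x::polish_space set \<Rightarrow> 'f) \<Rightarrow> ((nat \<Rightarrow> 'x) \<Rightarrow> 'f::{real_normed_field,euclidean_space}) \<Rightarrow> bool"
  where "power_integrable k \<sigma> f \<longleftrightarrow> (\<forall>c. integrable (\<Pi>\<^sub>M i\<in>{..<k}. jordan_part \<sigma> (c i)) f)"

lemma power_integrable_sum:
  "(\<And>j. j \<in> J \<Longrightarrow> power_integrable k \<sigma> (f j)) \<Longrightarrow> power_integrable k \<sigma> (\<lambda>x. \<Sum>j\<in>J. f j x)"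
  by (simp add: power_integrable_def)

lemma pairing_power_sum:
  assumes "\<And>j. j \<in> J \<Longrightarrow> power_integrable k \<sigma> (f j)"
  shows "pairing_power k \<sigma> (\<lambda>x. \<Sum>j\<in>J. f j x) = (\<Sum>j\<in>J. pairing_power k \<sigma> (f j))"
proof -
  have "(LINT x|(\<Pi>\<^sub>M i\<in>{..<k}. jordan_part \<sigma> (c i)). (\<Sum>j\<in>J. f j x)) =
      (\<Sum>j\<in>J. (LINT x|(\<Pi>\<^sub>M i\<in>{..<k}. jordan_part \<sigma> (c i)). f j x))" for c
    using assms by (intro Bochner_Integration.integral_sum) (auto simp: power_integrable_def)
  then show ?thesis
    unfolding pairing_power_def by (simp only: sum_distrib_left) (rule sum.swap)
qed

lemma pairing_power_cmult:
  "pairing_power k \<sigma> (\<lambda>x. c * f x) = c * pairing_power k \<sigma> f"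
  unfolding pairing_power_def by (simp add: sum_distrib_left mult_ac)

text \<open>Fubini factors every term of the multilinear expansion, and multiplying out the sums in
  \<open>pairing\<close> yields the same terms.\<close>

lemma pairing_power_tensor:
  fixes \<sigma> :: "'x::polish_space set \<Rightarrow> 'f::{real_normed_field,euclidean_space}"
  assumes lc: "locally_compact_space (euclidean :: 'x topology)" and \<sigma>: "\<sigma> \<in> radon_measures"
    and h: "\<And>j. j < k \<Longrightarrow> h j \<in> test_functions"
  shows power_integrable_tensor: "power_integrable k \<sigma> (\<lambda>x. \<Prod>j<k. h j (x j))"
    and "pairing_power k \<sigma> (\<lambda>x. \<Prod>j<k. h j (x j)) = (\<Prod>j<k. pairing \<sigma> (h j))"
proof -
  have int: "integrable (jordan_part \<sigma> i) (h j)" if "j \<in> {..<k}" for i j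
    using h that by (intro integrable_test_function \<sigma>) auto
  note psf = product_sigma_finite_jordan_part[OF lc \<sigma>]
  show "power_integrable k \<sigma> (\<lambda>x. \<Prod>j<k. h j (x j))"
    unfolding power_integrable_def
    by (intro allI product_sigma_finite.product_integrable_prod[OF psf] finite_lessThan int)
  have "(LINT x|(\<Pi>\<^sub>M i\<in>{..<k}. jordan_part \<sigma> (c i)). (\<Prod>j<k. h j (x j))) =
      (\<Prod>j<k. (LINT x|jordan_part \<sigma> (c j). h j x))" for c
    by (intro product_sigma_finite.product_integral_prod[OF psf] finite_lessThan int)
  then show "pairing_power k \<sigma> (\<lambda>x. \<Prod>j<k. h j (x j)) = (\<Prod>j<k. pairing \<sigma> (h j))"
    unfolding pairing_power_def pairing_def by (simp add: prod_sum_PiE prod.distrib)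
qed

text \<open>Multiplies out one factor of the product over \<open>L\<close> at a time. Integrability
  is carried along because splitting the resulting sum depends on it.\<close>

lemma pairing_power_tensor_eval:
  fixes \<sigma> :: "'x::polish_space set \<Rightarrow> 'f::{real_normed_field,euclidean_space}"
  assumes lc: "locally_compact_space (euclidean :: 'x topology)" and \<sigma>: "\<sigma> \<in> radon_measures"
    and "L \<in> lists test_functions" "\<And>j. j < m \<Longrightarrow> h j \<in> test_functions"
  shows "power_integrable m \<sigma> (\<lambda>x. (\<Prod>j<m. h j (x j)) * (\<Prod>\<xi>\<leftarrow>L. \<Sum>j<m. \<xi> (x j))) \<and>
    pairing_power m \<sigma> (\<lambda>x. (\<Prod>j<m. h j (x j)) * (\<Prod>\<xi>\<leftarrow>L. \<Sum>j<m. \<xi> (x j))) =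
      tensor_eval (pairing \<sigma>) m L h"
  using assms(3,4)
proof (induction L arbitrary: h)
  case Nil
  then show ?case
    using pairing_power_tensor[OF lc \<sigma>, of m h] by simp
next
  case (Cons \<xi> L)
  let ?h = "\<lambda>j. h(j := \<lambda>x. h j x * \<xi> x)"
  let ?f = "\<lambda>h x. (\<Prod>j<m. h j (x j)) * (\<Prod>\<xi>\<leftarrow>L. \<Sum>j<m. \<xi> (x j))"
  have eq: "(\<Prod>j<m. h j (x j)) * (\<Prod>\<xi>\<leftarrow>\<xi> # L. \<Sum>j<m. \<xi> (x j)) = (\<Sum>i<m. ?f (?h i) x)" for x
  proof -
    have "(\<Prod>j<m. ?h i j (x j)) = (\<Prod>j<m. h j (x j)) * \<xi> (x i)" if "i < m" for i
    proof -
      have "(\<Prod>j<m. ?h i j (x j)) = (\<Prod>j<m. h j (x j) * (if j = i then \<xi> (x i) else 1))"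
        by (intro prod.cong) auto
      then show ?thesis
        using that by (simp add: prod.distrib)
    qed
    then have "(\<Sum>i<m. ?f (?h i) x) =
        (\<Sum>i<m. (\<Prod>j<m. h j (x j)) * (\<Prod>\<xi>\<leftarrow>L. \<Sum>j<m. \<xi> (x j)) * \<xi> (x i))"
      by (intro sum.cong refl) (simp add: mult_ac)
    also have "\<dots> = (\<Prod>j<m. h j (x j)) * (\<Prod>\<xi>\<leftarrow>L. \<Sum>j<m. \<xi> (x j)) * (\<Sum>i<m. \<xi> (x i))"
      by (simp only: sum_distrib_left)
    finally show ?thesis
      by (simp only: list.map prod_list.Cons mult_ac)
  qed
  have IH: "power_integrable m \<sigma> (?f (?h i))"
      "pairing_power m \<sigma> (?f (?h i)) = tensor_eval (pairing \<sigma>) m L (?h i)" if "i < m" for i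
  proof -
    have "?h i j \<in> test_functions" if "j < m" for j
      using Cons.prems Cons.hyps \<open>i < m\<close> that by (auto intro: test_functions_mult)
    then show "power_integrable m \<sigma> (?f (?h i))"
        "pairing_power m \<sigma> (?f (?h i)) = tensor_eval (pairing \<sigma>) m L (?h i)"
      using Cons.IH[of "?h i"] by blast+
  qed
  have "power_integrable m \<sigma> (\<lambda>x. \<Sum>i<m. ?f (?h i) x)"
    using IH by (intro power_integrable_sum) auto
  moreover have "pairing_power m \<sigma> (\<lambda>x. \<Sum>i<m. ?f (?h i) x) = tensor_eval (pairing \<sigma>) m (\<xi> # L) h"
    using IH by (subst pairing_power_sum) auto
  ultimately show ?case
    unfolding eq by blast
qed

lemma poisson_expectation_on_moments:
  fixes \<sigma> :: "'x::polish_space set \<Rightarrow> 'f::{real_normed_field,euclidean_space}"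
  assumes lc: "locally_compact_space (euclidean :: 'x topology)" and \<sigma>: "\<sigma> \<in> radon_measures"
    and \<Lambda>: "\<Lambda> \<in> relcompact_borel" and L: "L \<in> lists test_functions"
  shows "poisson_expectation_on \<sigma> \<Lambda> (\<lambda>\<omega>. \<Prod>\<xi>\<leftarrow>L. pairing \<omega> \<xi>) =
    exp (- \<sigma> \<Lambda>) * (\<Sum>m. inverse (fact m) * tensor_eval (pairing \<sigma>) m L (\<lambda>_. indicator \<Lambda>))"
proof -
  have "pairing_power m \<sigma> (\<lambda>x. indicator ({..<m} \<rightarrow>\<^sub>E \<Lambda>) x * (\<Prod>\<xi>\<leftarrow>L. pairing (dirac_sum m x) \<xi>)) =
      tensor_eval (pairing \<sigma>) m L (\<lambda>_. indicator \<Lambda>)" for m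
  proof -
    \<comment> \<open>The right-hand side ignores coordinates from m on, so this is claimed for
      extensional x, which are all the points of the product space.\<close>
    have "indicator ({..<m} \<rightarrow>\<^sub>E \<Lambda>) x = (\<Prod>j<m. indicator \<Lambda> (x j) :: 'f)"
      if x: "x \<in> {..<m} \<rightarrow>\<^sub>E UNIV" for x :: "nat \<Rightarrow> 'x"
    proof (cases "x \<in> {..<m} \<rightarrow>\<^sub>E \<Lambda>")
      case True
      then show ?thesis by (auto simp: PiE_iff)
    next
      case False
      then obtain j where "j < m" "x j \<notin> \<Lambda>"
        using x by (auto simp: PiE_iff)
      then have "(\<Prod>j<m. indicator \<Lambda> (x j) :: 'f) = 0"
        by (intro prod_zero) (auto intro!: bexI[of _ j])
      then show ?thesis
        using False by simp
    qed
    moreover have "map (\<lambda>\<xi>. pairing (dirac_sum m x) \<xi>) L = map (\<lambda>\<xi>. \<Sum>j<m. \<xi> (x j)) L" for x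
      using L by (auto simp: pairing_dirac_sum)
    ultimately have "pairing_power m \<sigma>
        (\<lambda>x. indicator ({..<m} \<rightarrow>\<^sub>E \<Lambda>) x * (\<Prod>\<xi>\<leftarrow>L. pairing (dirac_sum m x) \<xi>)) =
        pairing_power m \<sigma> (\<lambda>x. (\<Prod>j<m. indicator \<Lambda> (x j)) * (\<Prod>\<xi>\<leftarrow>L. \<Sum>j<m. \<xi> (x j)))"
      by (intro pairing_power_cong) (simp only:)
    also have "\<dots> = tensor_eval (pairing \<sigma>) m L (\<lambda>_. indicator \<Lambda>)"
      by (rule conjunct2[OF pairing_power_tensor_eval[OF lc \<sigma> L indicator_test_function[OF \<Lambda>]]])
    finally show ?thesis .
  qed
  then show ?thesis
    by (simp add: poisson_expectation_on_def)
qed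

section \<open>Dependence on the support\<close>

text \<open>Restricting a product measure to a box gives the product of the restricted measures, by
  uniqueness on boxes. Integrals of functions supported in the box thus depend only on the factors
  inside \<Lambda>.\<close>

lemma integral_PiM_density:
  fixes f :: "('i \<Rightarrow> 'x::topological_space) \<Rightarrow> 'f::{banach,second_countable_topology}"
  assumes M: "product_sigma_finite M" and I: "finite I"
    and sets: "\<And>i. sets (M i) = sets borel" and \<Lambda>: "\<Lambda> \<in> sets borel"
    and fin: "\<And>i. emeasure (M i) \<Lambda> < \<infinity>"
    and f: "f \<in> borel_measurable (\<Pi>\<^sub>M i\<in>I. borel)"
    and zero: "\<And>x. x \<in> (I \<rightarrow>\<^sub>E UNIV) - (I \<rightarrow>\<^sub>E \<Lambda>) \<Longrightarrow> f x = 0"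
  shows "(LINT x|Pi\<^sub>M I M. f x) = (LINT x|(\<Pi>\<^sub>M i\<in>I. density (M i) (indicator \<Lambda>)). f x)"
proof -
  interpret product_sigma_finite M by (rule M)
  define D where "D i = density (M i) (indicator \<Lambda>)" for i
  have [simp]: "sets (M i) = sets borel" "\<Lambda> \<in> sets borel" for i
    using sets \<Lambda> by auto
  have space: "space (M i) = UNIV" for i
    using sets_eq_imp_space_eq[OF sets] by simp
  have D: "emeasure (D i) A = emeasure (M i) (\<Lambda> \<inter> A)" if "A \<in> sets borel" for i A
    using that unfolding D_def by (intro emeasure_restricted) auto
  interpret D: product_sigma_finite D
  proof
    fix i
    have "finite_measure (D i)"
      by (rule finite_measureI) (use D[of UNIV i] fin[of i] space in \<open>auto simp: D_def\<close>)
    then show "\<exists>A. countable A \<and> A \<subseteq> sets (D i) \<and> \<Union>A = space (D i) \<and> (\<forall>a\<in>A. emeasure (D i) a \<noteq> \<infinity>)"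
      using finite_measure.axioms(1) sigma_finite_measure.sigma_finite_countable by blast
  qed
  let ?\<Lambda>I = "I \<rightarrow>\<^sub>E \<Lambda>"
  have \<Lambda>I: "?\<Lambda>I \<in> sets (Pi\<^sub>M I M)"
    using I by (intro sets_PiM_I_finite) auto
  have "density (Pi\<^sub>M I M) (indicator ?\<Lambda>I) = Pi\<^sub>M I D"
  proof (rule D.PiM_eqI[OF I])
    show "sets (density (Pi\<^sub>M I M) (indicator ?\<Lambda>I)) = sets (Pi\<^sub>M I D)"
      by (auto intro!: sets_PiM_cong simp: D_def)
    fix A assume "\<And>i. i \<in> I \<Longrightarrow> A i \<in> sets (D i)"
    then have A: "A i \<in> sets borel" if "i \<in> I" for i
      using that by (simp add: D_def)
    have "emeasure (density (Pi\<^sub>M I M) (indicator ?\<Lambda>I)) (Pi\<^sub>E I A) =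
        emeasure (Pi\<^sub>M I M) (?\<Lambda>I \<inter> Pi\<^sub>E I A)"
      using A I by (intro emeasure_restricted \<Lambda>I sets_PiM_I_finite) auto
    also have "?\<Lambda>I \<inter> Pi\<^sub>E I A = (\<Pi>\<^sub>E i\<in>I. \<Lambda> \<inter> A i)"
      by (rule PiE_Int)
    also have "emeasure (Pi\<^sub>M I M) \<dots> = (\<Prod>i\<in>I. emeasure (M i) (\<Lambda> \<inter> A i))"
      using A I by (intro emeasure_PiM) auto
    also have "\<dots> = (\<Prod>i\<in>I. emeasure (D i) (A i))"
      using A by (simp add: D)
    finally show "emeasure (density (Pi\<^sub>M I M) (indicator ?\<Lambda>I)) (Pi\<^sub>E I A) =
        (\<Prod>i\<in>I. emeasure (D i) (A i))" .
  qed
  then have "(LINT x|Pi\<^sub>M I D. f x) = (LINT x|density (Pi\<^sub>M I M) (\<lambda>x. ennreal (indicator ?\<Lambda>I x)). f x)"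
    by (simp add: ennreal_indicator)
  also have "\<dots> = (LINT x|Pi\<^sub>M I M. indicator ?\<Lambda>I x *\<^sub>R f x)"
  proof (rule integral_density)
    have "sets (Pi\<^sub>M I M) = sets (\<Pi>\<^sub>M i\<in>I. borel)"
      by (intro sets_PiM_cong) auto
    then show "f \<in> borel_measurable (Pi\<^sub>M I M)"
      using f by (simp cong: measurable_cong_sets)
    show "indicator ?\<Lambda>I \<in> borel_measurable (Pi\<^sub>M I M)"
      using \<Lambda>I by simp
  qed simp
  also have "\<dots> = (LINT x|Pi\<^sub>M I M. f x)"
    by (intro Bochner_Integration.integral_cong refl)
      (use zero in \<open>auto simp: space_PiM space indicator_def\<close>)
  finally show ?thesis
    unfolding D_def[abs_def] ..
qed

text \<open>A kernel supported in \<Lambda> cannot distinguish measures that agree inside \<Lambda>;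
  this drives the argument about the support of p.\<close>

lemma pairing_power_local:
  fixes \<omega> \<omega>' :: "'x::polish_space set \<Rightarrow> 'f::{real_normed_field,euclidean_space}"
  assumes lc: "locally_compact_space (euclidean :: 'x topology)"
    and \<omega>: "\<omega> \<in> radon_measures" and \<omega>': "\<omega>' \<in> radon_measures" and \<Lambda>: "\<Lambda> \<in> relcompact_borel"
    and eq: "\<And>B. B \<in> relcompact_borel \<Longrightarrow> B \<subseteq> \<Lambda> \<Longrightarrow> \<omega> B = \<omega>' B"
    and f: "f \<in> sym_test_functions k" "vanishes_outside k \<Lambda> f"
  shows "pairing_power k \<omega> f = pairing_power k \<omega>' f"
proof -
  note \<Lambda>s = relcompact_borel_sets[OF \<Lambda>]
  have "density (jordan_part \<omega> j) (indicator \<Lambda>) = density (jordan_part \<omega>' j) (indicator \<Lambda>)" for j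
  proof (rule measure_eqI)
    fix A assume "A \<in> sets (density (jordan_part \<omega> j) (indicator \<Lambda>))"
    then have A: "A \<in> sets borel"
      by simp
    \<comment> \<open>The suprema defining both sides run over subsets of \<Lambda>, where \<omega>
      and \<omega>' agree.\<close>
    have "emeasure (jordan_part \<omega> j) (\<Lambda> \<inter> A) = emeasure (jordan_part \<omega>' j) (\<Lambda> \<inter> A)"
      using A \<Lambda>s eq unfolding jordan_part_def
      by (simp add: emeasure_upper_variation jordan_component_radon \<omega> \<omega>' upper_sup_def
          cong: SUP_cong_simp)
    then show "emeasure (density (jordan_part \<omega> j) (indicator \<Lambda>)) A =
        emeasure (density (jordan_part \<omega>' j) (indicator \<Lambda>)) A"
      using A \<Lambda>s by (simp add: emeasure_restricted)
  qed simp
  moreover have "(LINT x|(\<Pi>\<^sub>M i\<in>{..<k}. jordan_part \<theta> (c i)). f x) =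
      (LINT x|(\<Pi>\<^sub>M i\<in>{..<k}. density (jordan_part \<theta> (c i)) (indicator \<Lambda>)). f x)"
    if "\<theta> \<in> radon_measures" for \<theta> :: "'x set \<Rightarrow> 'f" and c
    using f \<Lambda>s emeasure_jordan_part_finite[OF that \<Lambda>]
    by (intro integral_PiM_density product_sigma_finite_jordan_part[OF lc that])
      (auto simp: sym_test_functions_def vanishes_outside_def)
  ultimately show ?thesis
    unfolding pairing_power_def by (simp add: \<omega> \<omega>')
qed

text \<open>Adds one point y with coefficient t for each new function. Every function excludes at
  most one t, and the field is infinite.\<close>

lemma discrete_measure_nonvanishing:
  fixes f :: "'i \<Rightarrow> 'x \<Rightarrow> 'f::{real_normed_field}"
  assumes "finite I" "\<And>i. i \<in> I \<Longrightarrow> \<exists>x. f i x \<noteq> 0"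
  shows "\<exists>(m::nat) c x. \<forall>i\<in>I. (\<Sum>k<m. c k * f i (x k)) \<noteq> 0"
  using assms
proof (induction I)
  case (insert i I)
  obtain m :: nat and c x where mcx: "\<And>k. k \<in> I \<Longrightarrow> (\<Sum>l<m. c l * f k (x l)) \<noteq> 0"
    using insert by blast
  obtain y where y: "f i y \<noteq> 0"
    using insert.prems by blast
  let ?a = "\<lambda>k. \<Sum>l<m::nat. c l * f k (x l)"
  have "finite {t. ?a k + t * f k y = 0}" if "k \<in> insert i I" for k
  proof (cases "f k y = 0")
    case True
    then have "?a k \<noteq> 0"
      using that y mcx by auto
    then show ?thesis
      using True by simp
  next
    case False
    then have "{t. ?a k + t * f k y = 0} \<subseteq> {- ?a k / f k y}"
      by (auto simp: field_simps eq_neg_iff_add_eq_0)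
    then show ?thesis
      by (rule finite_subset) simp
  qed
  then have "finite (\<Union>k\<in>insert i I. {t. ?a k + t * f k y = 0})"
    using insert.hyps by blast
  then obtain t where t: "t \<notin> (\<Union>k\<in>insert i I. {t. ?a k + t * f k y = 0})"
    using ex_new_if_finite infinite_UNIV_char_0 by blast
  have "(\<Sum>l<Suc m. (c(m := t)) l * f k ((x(m := y)) l)) = ?a k + t * f k y" for k
    by simp
  then show ?case
    using t by (intro exI[of _ "Suc m"] exI[of _ "c(m := t)"] exI[of _ "x(m := y)"]) auto
qed simp

text \<open>
  If some \<open>\<xi> a\<close> did not vanish outside \<open>\<Lambda>\<close>, say at \<open>y\<close>, one could add to a discrete measure with
  nonzero pairings a multiple of the point mass at \<open>y\<close> that kills the pairing with \<open>\<xi> a\<close>; this changes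
  the product but not the polynomial, which only sees \<open>\<Lambda>\<close>.
\<close>

lemma poly_repr_support:
  fixes \<xi> :: "'i \<Rightarrow> 'x::polish_space \<Rightarrow> 'f::{real_normed_field,euclidean_space}"
  assumes lc: "locally_compact_space (euclidean :: 'x topology)" and \<Lambda>: "\<Lambda> \<in> relcompact_borel"
    and repr: "poly_repr (\<lambda>\<omega>. \<Prod>i\<in>I. pairing \<omega> (\<xi> i)) N f" "\<And>k. k \<le> N \<Longrightarrow> vanishes_outside k \<Lambda> (f k)"
    and I: "finite I" and \<xi>: "\<And>i. i \<in> I \<Longrightarrow> \<xi> i \<in> test_functions" "\<And>i. i \<in> I \<Longrightarrow> \<exists>x. \<xi> i x \<noteq> 0"
    and a: "a \<in> I" and y: "y \<notin> \<Lambda>"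
  shows "\<xi> a y = 0"
proof (rule ccontr)
  assume ne: "\<xi> a y \<noteq> 0"
  obtain m :: nat and c x where mcx: "\<And>i. i \<in> I \<Longrightarrow> (\<Sum>k<m. c k * \<xi> i (x k)) \<noteq> 0"
    using discrete_measure_nonvanishing[OF I, of \<xi>] \<xi>(2) by blast
  define t where "t = - (\<Sum>k<m. c k * \<xi> a (x k)) / \<xi> a y"
  let ?\<omega> = "discrete_measure m c x"
  let ?\<omega>' = "discrete_measure (Suc m) (c(m := t)) (x(m := y))"
  have "(\<Prod>i\<in>I. pairing ?\<omega> (\<xi> i)) \<noteq> 0"
    using mcx \<xi> I by (simp add: pairing_discrete_measure)
  moreover have "pairing ?\<omega>' (\<xi> a) = 0"
    using ne \<xi>(1)[OF a] by (simp add: pairing_discrete_measure t_def)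
  then have "(\<Prod>i\<in>I. pairing ?\<omega>' (\<xi> i)) = 0"
    using a I by (intro prod_zero) auto
  moreover have "(\<Prod>i\<in>I. pairing ?\<omega> (\<xi> i)) = (\<Prod>i\<in>I. pairing ?\<omega>' (\<xi> i))"
  proof -
    have "?\<omega> B = ?\<omega>' B" if "B \<subseteq> \<Lambda>" for B
    proof -
      have "y \<notin> B"
        using that y by blast
      then show ?thesis
        by (simp add: discrete_measure_def)
    qed
    then have "pairing_power k ?\<omega> (f k) = pairing_power k ?\<omega>' (f k)" if "k \<le> N" for k
      using that repr by (intro pairing_power_local[OF lc _ _ \<Lambda>] discrete_measure_radon)
        (auto simp: poly_repr_def)
    then show ?thesis
      using repr(1) by (simp add: poly_repr_def discrete_measure_radon)
  qed
  ultimately show False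
    by simp
qed

lemma zero_sym_test_function: "(\<lambda>_. 0) \<in> sym_test_functions k"
  by (auto simp: sym_test_functions_def vanishes_outside_def bounded_iff)

text \<open>Guarantees that the choice in \<open>poisson_functional\<close> has a candidate. The
  kernel of degree n is the symmetrized tensor product of the \<open>g i\<close>; symmetrizing does
  not change its integral, since all n coordinates carry the same \<omega>.\<close>

lemma product_poly_repr:
  fixes g :: "nat \<Rightarrow> 'x::polish_space \<Rightarrow> 'f::{real_normed_field,euclidean_space}"
  assumes lc: "locally_compact_space (euclidean :: 'x topology)"
    and g: "\<And>i. i < n \<Longrightarrow> g i \<in> test_functions"
  shows "\<exists>\<Lambda>\<in>relcompact_borel. \<exists>N f. poly_repr (\<lambda>\<omega>. \<Prod>i<n. pairing \<omega> (g i)) N f \<and>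
    (\<forall>k\<le>N. vanishes_outside k \<Lambda> (f k))"
proof -
  obtain K where K: "\<And>i. i < n \<Longrightarrow> compact (K i) \<and> (\<forall>x. x \<notin> K i \<longrightarrow> g i x = 0)"
    using g unfolding test_functions_def mem_Collect_eq by metis
  obtain B where B: "\<And>i x. i < n \<Longrightarrow> norm (g i x) \<le> B i"
    using g unfolding test_functions_def bounded_iff mem_Collect_eq by (metis rangeI)
  define \<Lambda> where "\<Lambda> = (\<Union>i<n. K i)"
  have \<Lambda>: "compact \<Lambda>" "\<And>i x. i < n \<Longrightarrow> x \<notin> \<Lambda> \<Longrightarrow> g i x = 0"
    using K by (auto simp: \<Lambda>_def)
  let ?P = "{\<pi>. \<pi> permutes {..<n}}"
  define t where "t \<pi> x = (\<Prod>j<n. g (\<pi> j) (x j))" for \<pi> :: "nat \<Rightarrow> nat" and x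
  define f where "f x = inverse (fact n) * (\<Sum>\<pi>\<in>?P. t \<pi> x)" for x
  have \<pi>_less: "\<pi> j < n" if "\<pi> \<in> ?P" "j < n" for \<pi> j
    using that permutes_in_image[of \<pi> "{..<n}" j] by auto
  have vanish: "vanishes_outside n \<Lambda> f"
    unfolding vanishes_outside_def
  proof
    fix x assume "x \<in> ({..<n} \<rightarrow>\<^sub>E UNIV) - ({..<n} \<rightarrow>\<^sub>E \<Lambda>)"
    then obtain j where "j < n" "x j \<notin> \<Lambda>"
      by (auto simp: PiE_iff)
    then have "t \<pi> x = 0" if "\<pi> \<in> ?P" for \<pi>
      unfolding t_def using \<Lambda>(2) \<pi>_less[OF that] by (intro prod_zero) auto
    then show "f x = 0"
      by (simp add: f_def)
  qed
  have "t \<pi> \<in> borel_measurable (\<Pi>\<^sub>M i\<in>{..<n}. borel)" if "\<pi> \<in> ?P" for \<pi>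
    unfolding t_def
  proof (intro borel_measurable_prod)
    fix j assume "j \<in> {..<n}"
    then show "(\<lambda>x. g (\<pi> j) (x j)) \<in> borel_measurable (\<Pi>\<^sub>M i\<in>{..<n}. borel)"
      using \<pi>_less[OF that] g
      by (intro measurable_compose[OF measurable_component_singleton] test_function_borel) auto
  qed
  then have "f \<in> borel_measurable (\<Pi>\<^sub>M i\<in>{..<n}. borel)"
    unfolding f_def by (intro borel_measurable_times borel_measurable_sum) auto
  moreover have "bounded (f ` ({..<n} \<rightarrow>\<^sub>E UNIV))"
  proof -
    have t_le: "norm (t \<pi> x) \<le> (\<Prod>j<n. B (\<pi> j))" if "\<pi> \<in> ?P" for \<pi> x
      unfolding t_def prod_norm[symmetric] using B \<pi>_less[OF that] by (intro prod_mono) auto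
    have "norm (f x) \<le> norm (inverse (fact n) :: 'f) * (\<Sum>\<pi>\<in>?P. \<Prod>j<n. B (\<pi> j))" for x
      unfolding f_def norm_mult by (intro mult_left_mono sum_norm_le t_le) auto
    then show ?thesis
      unfolding bounded_iff by blast
  qed
  moreover have "f (x \<circ> \<rho>) = f x" if \<rho>: "\<rho> permutes {..<n}" for \<rho> x
  proof -
    \<comment> \<open>Permuting the coordinates is a right translation on the permutations, which
      leaves the sum over all of them unchanged.\<close>
    have "t \<pi> (x \<circ> \<rho>) = t (\<pi> \<circ> inv \<rho>) x" for \<pi>
      unfolding t_def
      using prod.permute[OF permutes_inv[OF \<rho>], of "\<lambda>j. g (\<pi> j) (x (\<rho> j))"] permutes_inverses(1)[OF \<rho>]
      by (simp add: comp_def)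
    then have "(\<Sum>\<pi>\<in>?P. t \<pi> (x \<circ> \<rho>)) = (\<Sum>\<pi>\<in>?P. t (\<pi> \<circ> inv \<rho>) x)"
      by simp
    also have "\<dots> = (\<Sum>\<pi>\<in>?P. t \<pi> x)"
      using sum_permutations_compose_right[OF permutes_inv[OF \<rho>], of "\<lambda>\<pi>. t \<pi> x"] by (simp add: comp_def)
    finally show ?thesis
      by (simp add: f_def)
  qed
  ultimately have sym: "f \<in> sym_test_functions n"
    unfolding sym_test_functions_def using vanish \<Lambda>(1) by blast
  have pp: "pairing_power n \<omega> f = (\<Prod>i<n. pairing \<omega> (g i))" if \<omega>: "\<omega> \<in> radon_measures" for \<omega>
  proof -
    have *: "power_integrable n \<omega> (t \<pi>)" "pairing_power n \<omega> (t \<pi>) = (\<Prod>i<n. pairing \<omega> (g i))"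
      if "\<pi> \<in> ?P" for \<pi>
    proof -
      have h: "g (\<pi> j) \<in> test_functions" if "j < n" for j
        using g \<pi>_less[OF \<open>\<pi> \<in> ?P\<close> that] by blast
      show "power_integrable n \<omega> (t \<pi>)"
        unfolding t_def by (rule power_integrable_tensor[OF lc \<omega>]) (rule h)
      have "pairing_power n \<omega> (t \<pi>) = (\<Prod>i<n. pairing \<omega> (g (\<pi> i)))"
        unfolding t_def by (rule pairing_power_tensor[OF lc \<omega>]) (rule h)
      then show "pairing_power n \<omega> (t \<pi>) = (\<Prod>i<n. pairing \<omega> (g i))"
        using prod.permute[of \<pi> "{..<n}" "\<lambda>i. pairing \<omega> (g i)"] that by (simp add: comp_def)
    qed
    have "pairing_power n \<omega> f = inverse (fact n) * (\<Sum>\<pi>\<in>?P. pairing_power n \<omega> (t \<pi>))"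
      unfolding f_def pairing_power_cmult using * by (subst pairing_power_sum) auto
    also have "\<dots> = inverse (fact n) * (of_nat (card ?P) * (\<Prod>i<n. pairing \<omega> (g i)))"
      using * by simp
    also have "card ?P = fact n"
      by (rule card_permutations) auto
    finally show ?thesis
      by simp
  qed
  let ?f = "\<lambda>k. if k = n then f else (\<lambda>_. 0)"
  have "pairing_power k \<omega> (\<lambda>_. 0) = 0" for k and \<omega> :: "'x set \<Rightarrow> 'f"
    using pairing_power_cmult[of k \<omega> 0 "\<lambda>_. 0"] by simp
  then have "pairing_power k \<omega> (?f k) = (if k = n then pairing_power n \<omega> f else 0)" for k \<omega>
    by simp
  then have "poly_repr (\<lambda>\<omega>. \<Prod>i<n. pairing \<omega> (g i)) n ?f"
    unfolding poly_repr_def using sym pp by (simp add: zero_sym_test_function)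
  moreover have "\<forall>k\<le>n. vanishes_outside k \<Lambda> (?f k)"
    using vanish by (auto simp: vanishes_outside_def)
  ultimately show ?thesis
    using compact_relcompact_borel[OF \<Lambda>(1)] by blast
qed

section \<open>Vacuum expectations as Poisson moments\<close>

text \<open>The functions are confined to \<Lambda> so that the indicator of \<Lambda> is a unit for
  them, as the Mecke step demands. The factor exp(-\<sigma>(\<Lambda>)) cancels the value
  exp(\<sigma>(\<Lambda>)) of the series at the empty list, so both sides start at 1.\<close>

lemma vacuum_eq_poisson_expectation_on:
  fixes \<sigma> :: "'x::polish_space set \<Rightarrow> 'f::{real_normed_field,euclidean_space}"
    and smul :: "'f \<Rightarrow> 'v::ab_group_add \<Rightarrow> 'v"
  assumes lc: "locally_compact_space (euclidean :: 'x topology)"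
    and \<sigma>: "\<sigma> \<in> radon_measures"
    and ops: "current_operators smul \<sigma> ap am rho"
    and \<tau>: "vacuum_functional smul ap am rho \<tau>"
    and \<Lambda>: "\<Lambda> \<in> relcompact_borel"
    and L: "L \<in> lists {\<xi> \<in> test_functions. \<forall>x. x \<notin> \<Lambda> \<longrightarrow> \<xi> x = 0}"
  shows "\<tau> (word (field_operator smul \<sigma> ap am rho) L) =
    poisson_expectation_on \<sigma> \<Lambda> (\<lambda>\<omega>. \<Prod>\<xi>\<leftarrow>L. pairing \<omega> \<xi>)"
proof -
  let ?T = "{\<xi> \<in> test_functions. \<forall>x. x \<notin> \<Lambda> \<longrightarrow> \<xi> x = 0} :: ('x \<Rightarrow> 'f) set"
  let ?R = "field_operator smul \<sigma> ap am rho"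
  let ?F = "\<lambda>L. \<Sum>m. inverse (fact m) * tensor_eval (pairing \<sigma>) m L (\<lambda>_. indicator \<Lambda>)"
  have e: "(\<lambda>x. indicator \<Lambda> x * \<phi> x) = \<phi>" if "\<phi> \<in> ?T" for \<phi>
    using that by (auto simp: indicator_def fun_eq_iff)
  have lists: "M \<in> lists test_functions" if "M \<in> lists ?T" for M
    using that by auto
  have "\<tau> (word ?R L) = exp (- \<sigma> \<Lambda>) * ?F L"
  proof (rule absorb_recursion_unique[where T = ?T and \<mu> = "\<lambda>L. \<tau> (word ?R L)"
        and \<nu> = "\<lambda>L. exp (- \<sigma> \<Lambda>) * ?F L" and w = "pairing \<sigma>"])
    have "exp (- \<sigma> \<Lambda>) * ?F [] = exp (- \<sigma> \<Lambda>) * exp (\<sigma> \<Lambda>)"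
      using tensor_eval_series_Nil[of ?T "indicator \<Lambda>" "pairing \<sigma>", OF e]
      by (simp add: pairing_indicator[OF \<sigma> \<Lambda>])
    also have "\<dots> = 1"
      by (simp add: exp_minus_inverse[of "- \<sigma> \<Lambda>", simplified])
    finally show "\<tau> (word ?R []) = exp (- \<sigma> \<Lambda>) * ?F []"
      using current_operators.vacuum_id[OF ops \<tau>] by simp
  next
    fix \<phi> M assume "\<phi> \<in> ?T" "M \<in> lists ?T"
    then show "\<tau> (word ?R (\<phi> # M)) = absorb (pairing \<sigma>) \<phi> M (\<lambda>L. \<tau> (word ?R L))"
      using lists by (intro current_operators.vacuum_moment_recursion[OF ops \<tau>]) auto
    show "exp (- \<sigma> \<Lambda>) * ?F (\<phi> # M) =
        absorb (pairing \<sigma>) \<phi> M (\<lambda>L. exp (- \<sigma> \<Lambda>) * ?F L)"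
      unfolding absorb_cmult
      using tensor_eval_series_Cons[of ?T "indicator \<Lambda>" \<phi> M "pairing \<sigma>", OF e]
        \<open>\<phi> \<in> ?T\<close> \<open>M \<in> lists ?T\<close> by (simp only:)
  qed (rule L)
  then show ?thesis
    by (simp only: poisson_expectation_on_moments[OF lc \<sigma> \<Lambda> lists[OF L]])
qed

theorem theorem7p11:
  fixes \<sigma> :: "'x::polish_space set \<Rightarrow> 'f::{real_normed_field,euclidean_space}"
    and smul :: "'f \<Rightarrow> 'v::ab_group_add \<Rightarrow> 'v"
    and ap am rho :: "('x \<Rightarrow> 'f) \<Rightarrow> 'v \<Rightarrow> 'v"
    and \<tau> :: "('v \<Rightarrow> 'v) \<Rightarrow> 'f"
    and n :: nat
    and \<xi> :: "nat \<Rightarrow> 'x \<Rightarrow> 'f"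
  assumes "locally_compact_space (euclidean :: 'x topology)"
    and "\<sigma> \<in> radon_measures"
    and "current_operators smul \<sigma> ap am rho"
    and "vacuum_functional smul ap am rho \<tau>"
    and "n \<ge> 1"
    and "\<And>i. i \<in> {1..n} \<Longrightarrow> \<xi> i \<in> test_functions"
  shows "\<tau> (foldr (\<circ>) (map (\<lambda>i. field_operator smul \<sigma> ap am rho (\<xi> i)) [1..<Suc n]) id)
       = poisson_functional \<sigma> (\<lambda>\<omega>. \<Prod>i=1..n. pairing \<omega> (\<xi> i))"
proof -
  let ?p = "\<lambda>\<omega>. \<Prod>i=1..n. pairing \<omega> (\<xi> i)"
  let ?L = "map \<xi> [1..<Suc n]"
  have set_L: "set [1..<Suc n] = {1..n}"
    by auto
  have p_eq: "?p = (\<lambda>\<omega>. \<Prod>\<phi>\<leftarrow>?L. pairing \<omega> \<phi>)"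
  proof
    fix \<omega> :: "'x set \<Rightarrow> 'f"
    have "(\<Prod>i\<in>set [1..<Suc n]. pairing \<omega> (\<xi> i)) = (\<Prod>i\<leftarrow>[1..<Suc n]. pairing \<omega> (\<xi> i))"
      by (rule prod.distinct_set_conv_list) simp
    then show "?p \<omega> = (\<Prod>\<phi>\<leftarrow>?L. pairing \<omega> \<phi>)"
      by (simp only: set_L map_map comp_def)
  qed
  have word_eq: "foldr (\<circ>) (map (\<lambda>i. field_operator smul \<sigma> ap am rho (\<xi> i)) [1..<Suc n]) id =
      word (field_operator smul \<sigma> ap am rho) ?L"
    by (simp only: word_def map_map comp_def)
  \<comment> \<open>Available for every region containing the supports; it remains to relate the
    chosen \<Lambda> to them.\<close>
  have main: "\<tau> (word (field_operator smul \<sigma> ap am rho) ?L) = poisson_expectation_on \<sigma> \<Lambda> ?p"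
    if "\<Lambda> \<in> relcompact_borel" "\<And>i x. i \<in> {1..n} \<Longrightarrow> x \<notin> \<Lambda> \<Longrightarrow> \<xi> i x = 0" for \<Lambda>
    unfolding p_eq using that assms(6)
    by (intro vacuum_eq_poisson_expectation_on[OF assms(1-4) that(1)]) auto
  let ?adm = "\<lambda>\<Lambda>. \<Lambda> \<in> relcompact_borel \<and>
    (\<exists>N f. poly_repr ?p N f \<and> (\<forall>k\<le>N. vanishes_outside k \<Lambda> (f k)))"
  define \<Lambda> where "\<Lambda> = (SOME \<Lambda>. ?adm \<Lambda>)"
  have "?p = (\<lambda>\<omega>. \<Prod>i<n. pairing \<omega> (\<xi> (Suc i)))"
    by (simp add: prod.atLeast1_atMost_eq)
  moreover have "\<xi> (Suc i) \<in> test_functions" if "i < n" for i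
    using assms(6) that by simp
  ultimately have "\<exists>\<Lambda>. ?adm \<Lambda>"
    using product_poly_repr[OF assms(1), of n "\<lambda>i. \<xi> (Suc i)"] by auto
  then have \<Lambda>: "?adm \<Lambda>"
    unfolding \<Lambda>_def by (rule someI_ex)
  have "\<tau> (word (field_operator smul \<sigma> ap am rho) ?L) = poisson_expectation_on \<sigma> \<Lambda> ?p"
  proof (cases "\<forall>i\<in>{1..n}. \<exists>x. \<xi> i x \<noteq> 0")
    case True
    obtain N f where "poly_repr ?p N f" "\<And>k. k \<le> N \<Longrightarrow> vanishes_outside k \<Lambda> (f k)"
      using \<Lambda> by blast
    then show ?thesis
      using \<Lambda> True assms(6) by (intro main poly_repr_support[OF assms(1)]) auto
  next
    case False
    then obtain a where a: "a \<in> {1..n}" "\<And>x. \<xi> a x = 0"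
      by blast
    have zero: "poisson_expectation_on \<sigma> \<Lambda>' ?p = 0" for \<Lambda>'
    proof -
      have "pairing \<omega> (\<xi> a) = 0" for \<omega>
        by (simp add: pairing_def a(2))
      then have p_zero: "?p = (\<lambda>_. 0)"
        using a(1) by (intro ext prod_zero) (auto intro!: bexI[of _ a])
      show ?thesis
        unfolding p_zero poisson_expectation_on_def
        using pairing_power_cmult[of _ \<sigma> 0 "\<lambda>_. 0"] by simp
    qed
    \<comment> \<open>As p = 0 here, the chosen \<Lambda> may miss the supports of the other
      factors. So \<open>main\<close> is applied to a region that does contain them, and both
      regions give 0.\<close>
    obtain K where K: "\<And>i. i \<in> {1..n} \<Longrightarrow> compact (K i) \<and> (\<forall>x. x \<notin> K i \<longrightarrow> \<xi> i x = 0)"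
      using assms(6) unfolding test_functions_def mem_Collect_eq by metis
    then have "compact (\<Union>i\<in>{1..n}. K i)"
      by (intro compact_UN) auto
    then have "\<tau> (word (field_operator smul \<sigma> ap am rho) ?L) =
        poisson_expectation_on \<sigma> (\<Union>i\<in>{1..n}. K i) ?p"
      using K by (intro main compact_relcompact_borel) auto
    then show ?thesis
      by (simp only: zero)
  qed
  then show ?thesis
    by (simp only: word_eq poisson_functional_def \<Lambda>_def)
qed

end
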